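(* Consider the linear regression model $y=X\theta+u$ (setting in the context), fix $n\ge 1$, an index $1\le i\le k$, a tuning parameter $\eta_{i,n}>0$, $\sigma>0$, and $\alpha\in(0,1)$. For non-negative reals $a_{i,n},b_{i,n}$: (a) The infimal coverage probability $\inf_{\theta\in\mathbb{R}^k}P_{n,\theta,\sigma}(\theta_i\in[\hat\theta_{H,i}-\sigma a_{i,n},\hat\theta_{H,i}+\sigma b_{i,n}])$ equals $\Phi(n^{1/2}(a_{i,n}/\xi_{i,n}-\eta_{i,n}))-\Phi(-n^{1/2}b_{i,n}/\xi_{i,n})$ if $\xi_{i,n}\eta_{i,n}\le a_{i,n}+b_{i,n}$ and $a_{i,n}\le b_{i,n}$; $\Phi(n^{1/2}(b_{i,n}/\xi_{i,n}-\eta_{i,n}))-\Phi(-n^{1/2}a_{i,n}/\xi_{i,n})$ if $\xi_{i,n}\eta_{i,n}\le a_{i,n}+b_{i,n}$ and $a_{i,n}> b_{i,n}$; $0$ if $\xi_{i,n}\eta_{i,n}> a_{i,n}+b_{i,n}$. Among all intervals $[\hat\theta_{H,i}-\sigma a_{i,n},\hat\theta_{H,i}+\sigma b_{i,n}]$ with infimal coverage probability not less than $1-\alpha$ there is a unique shortest one, $C_{H,i,n}=[\hat\theta_{H,i}-\sigma a^*_{H,i,n},\hat\theta_{H,i}+\sigma b^*_{H,i,n}]$, characterized by $a^*_{H,i,n}=b^*_{H,i,n}$ where $a^*_{H,i,n}$ is the unique solution in $a$ of $\Phi(n^{1/2}(a/\xi_{i,n}-\eta_{i,n}))-\Phi(-n^{1/2}a/\xi_{i,n})=1-\alpha$.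 The interval $C_{H,i,n}$ has infimal coverage probability equal to $1-\alpha$ and $a^*_{H,i,n}>\xi_{i,n}\eta_{i,n}/2$. (b) The infimal coverage probability $\inf_{\theta\in\mathbb{R}^k}P_{n,\theta,\sigma}(\theta_i\in[\hat\theta_{S,i}-\sigma a_{i,n},\hat\theta_{S,i}+\sigma b_{i,n}])$ equals $\Phi(n^{1/2}(a_{i,n}/\xi_{i,n}-\eta_{i,n}))-\Phi(n^{1/2}(-b_{i,n}/\xi_{i,n}-\eta_{i,n}))$ if $a_{i,n}\le b_{i,n}$, and $\Phi(n^{1/2}(b_{i,n}/\xi_{i,n}-\eta_{i,n}))-\Phi(n^{1/2}(-a_{i,n}/\xi_{i,n}-\eta_{i,n}))$ if $a_{i,n}> b_{i,n}$. Among all intervals $[\hat\theta_{S,i}-\sigma a_{i,n},\hat\theta_{S,i}+\sigma b_{i,n}]$ with infimal coverage probability not less than $1-\alpha$ there is a unique shortest one, $C_{S,i,n}=[\hat\theta_{S,i}-\sigma a^*_{S,i,n},\hat\theta_{S,i}+\sigma b^*_{S,i,n}]$, characterized by $a^*_{S,i,n}=b^*_{S,i,n}$ where $a^*_{S,i,n}$ is the unique solution in $a$ of $\Phi(n^{1/2}(a/\xi_{i,n}-\eta_{i,n}))-\Phi(n^{1/2}(-a/\xi_{i,n}-\eta_{i,n}))=1-\alpha$. The interval $C_{S,i,n}$ has infimal coverage probability equal to $1-\alpha$ and $a^*_{S,i,n}>0$. (c) The infimal coverage probability $\inf_{\theta\in\mathbb{R}^k}P_{n,\theta,\sigma}(\theta_i\in[\hat\theta_{AS,i}-\sigma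 a_{i,n},\hat\theta_{AS,i}+\sigma b_{i,n}])$ equals $\Phi(n^{1/2}(a_{i,n}/\xi_{i,n}-\eta_{i,n}))-\Phi\big(n^{1/2}\xi_{i,n}^{-1}\big((a_{i,n}-b_{i,n})/2-\sqrt{((a_{i,n}+b_{i,n})/2)^2+\xi_{i,n}^2\eta_{i,n}^2}\big)\big)$ if $a_{i,n}\le b_{i,n}$, and $\Phi(n^{1/2}(b_{i,n}/\xi_{i,n}-\eta_{i,n}))-\Phi\big(n^{1/2}\xi_{i,n}^{-1}\big((b_{i,n}-a_{i,n})/2-\sqrt{((a_{i,n}+b_{i,n})/2)^2+\xi_{i,n}^2\eta_{i,n}^2}\big)\big)$ if $a_{i,n}> b_{i,n}$. Among all intervals $[\hat\theta_{AS,i}-\sigma a_{i,n},\hat\theta_{AS,i}+\sigma b_{i,n}]$ with infimal coverage probability not less than $1-\alpha$ there is a unique shortest one, $C_{AS,i,n}=[\hat\theta_{AS,i}-\sigma a^*_{AS,i,n},\hat\theta_{AS,i}+\sigma b^*_{AS,i,n}]$, characterized by $a^*_{AS,i,n}=b^*_{AS,i,n}$ where $a^*_{AS,i,n}$ is the unique solution in $a$ of $\Phi(n^{1/2}(a/\xi_{i,n}-\eta_{i,n}))-\Phi\big(-n^{1/2}\sqrt{(a/\xi_{i,n})^2+\eta_{i,n}^2}\big)=1-\alpha$. The interval $C_{AS,i,n}$ has infimal coverage probability equal to $1-\alpha$ and $a^*_{AS,i,n}>0$.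
   Context: Model: for sample size $n$, $y=X\theta+u$ with $y\in\mathbb{R}^n$, $X$ a non-stochastic $n\times k$ matrix of rank $k\ge1$ ($k$ and the entries may depend on $n$), $\theta\in\mathbb{R}^k$, $u\sim N(0,\sigma^2I_n)$, $\sigma>0$. $P_{n,\theta,\sigma}$ is the probability under parameters $(\theta,\sigma)$ at sample size $n$. $\hat\theta_{LS}=(X'X)^{-1}X'y$, with $i$-th component $\hat\theta_{LS,i}$. $\xi_{i,n}\ge 0$ is the non-negative square root of the $i$-th diagonal element of $(X'X/n)^{-1}$. Given $\eta_{i,n}>0$, the (known-variance) estimators are: hard-thresholding $\hat\theta_{H,i}=\hat\theta_{LS,i}\mathbf{1}(|\hat\theta_{LS,i}|>\sigma\xi_{i,n}\eta_{i,n})$; soft-thresholding $\hat\theta_{S,i}=\operatorname{sgn}(\hat\theta_{LS,i})(|\hat\theta_{LS,i}|-\sigma\xi_{i,n}\eta_{i,n})_+$; adaptive soft-thresholding $\hat\theta_{AS,i}=\hat\theta_{LS,i}(1-\sigma^2\xi_{i,n}^2\eta_{i,n}^2/\hat\theta_{LS,i}^2)_+$, where $(x)_+=\max(x,0)$. $\Phi$ is the standard normal cdf. The "infimal coverage probability" of an interval is the infimum over $\theta\in\mathbb{R}^k$ of the probability that it contains $\theta_i$. *)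

theory Defs
  imports "HOL-Analysis.Analysis" "HOL-Probability.Probability"
begin

definition Phi :: "real \<Rightarrow> real" where
  "Phi x = measure (density lborel (\<lambda>t. ennreal (std_normal_density t))) {..x}"

text \<open>Law of y = X theta + u, u ~ N(0, sigma^2 I_n), on R^n (n = CARD('n), k = CARD('k)).\<close>
definition reg_model :: "real^'k^'n \<Rightarrow> real^'k \<Rightarrow> real \<Rightarrow> (real^'n) measure" where
  "reg_model X \<theta> \<sigma> =
     density lborel (\<lambda>y. ennreal (\<Prod>j\<in>UNIV. normal_density ((X *v \<theta>) $ j) \<sigma> (y $ j)))"

definition ls_est :: "real^'k^'n \<Rightarrow> real^'n \<Rightarrow> real^'k" where
  "ls_est X y = matrix_inv (transpose X ** X) *v (transpose X *v y)"

definition xi :: "real^'k^'n \<Rightarrow> 'k \<Rightarrow> real" where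
  "xi X i = sqrt (matrix_inv (inverse (real CARD('n)) *\<^sub>R (transpose X ** X)) $ i $ i)"

definition hard_est :: "real^'k^'n \<Rightarrow> real \<Rightarrow> real \<Rightarrow> 'k \<Rightarrow> real^'n \<Rightarrow> real" where
  "hard_est X \<sigma> \<eta> i y =
     (let t = ls_est X y $ i in if \<bar>t\<bar> > \<sigma> * xi X i * \<eta> then t else 0)"

definition soft_est :: "real^'k^'n \<Rightarrow> real \<Rightarrow> real \<Rightarrow> 'k \<Rightarrow> real^'n \<Rightarrow> real" where
  "soft_est X \<sigma> \<eta> i y =
     (let t = ls_est X y $ i in sgn t * max (\<bar>t\<bar> - \<sigma> * xi X i * \<eta>) 0)"

definition adsoft_est :: "real^'k^'n \<Rightarrow> real \<Rightarrow> real \<Rightarrow> 'k \<Rightarrow> real^'n \<Rightarrow> real" where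
  "adsoft_est X \<sigma> \<eta> i y =
     (let t = ls_est X y $ i in t * max (1 - \<sigma>\<^sup>2 * (xi X i)\<^sup>2 * \<eta>\<^sup>2 / t\<^sup>2) 0)"

definition inf_cov :: "real^'k^'n \<Rightarrow> real \<Rightarrow> 'k \<Rightarrow> (real^'n \<Rightarrow> real) \<Rightarrow> real \<Rightarrow> real \<Rightarrow> real" where
  "inf_cov X \<sigma> i est a b =
     (INF \<theta>\<in>UNIV. measure (reg_model X \<theta> \<sigma>)
        {y. est y - \<sigma> * a \<le> \<theta> $ i \<and> \<theta> $ i \<le> est y + \<sigma> * b})"

definition shortest :: "(real \<Rightarrow> real \<Rightarrow> real) \<Rightarrow> real \<Rightarrow> real \<Rightarrow> real \<Rightarrow> real \<Rightarrow> bool" where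
  "shortest C \<alpha> \<sigma> a b \<longleftrightarrow> 0 \<le> a \<and> 0 \<le> b \<and> C a b \<ge> 1 - \<alpha> \<and>
     (\<forall>a' b'. 0 \<le> a' \<and> 0 \<le> b' \<and> C a' b' \<ge> 1 - \<alpha> \<longrightarrow> \<sigma> * (a + b) \<le> \<sigma> * (a' + b'))"

end

theory Submission
  imports Defs "HOL-Real_Asymp.Real_Asymp"
begin

text \<open>
  The \<open>i\<close>-th least squares component is a linear functional of the Gaussian vector \<open>y\<close>, hence normal
  with mean \<open>\<theta>\<^sub>i\<close> and standard deviation \<open>\<tau> = \<sigma> \<xi> / s\<close>. Dividing by \<open>\<tau>\<close>, each estimator becomes an odd
  thresholding function \<open>T\<close> with threshold \<open>e = s \<eta>\<close> applied to \<open>m + w\<close>, where \<open>w\<close> is standard normal,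
  and the coverage at \<open>m\<close> is the normal probability of \<open>m - B \<le> T (m + w) \<le> m + A\<close>.
  By oddness one may assume \<open>A \<le> B\<close>. Among the three regions \<open>m < -A\<close>, \<open>-A \<le> m \<le> B\<close>, \<open>B < m\<close>, the
  infimum is approached as \<open>m\<close> increases to \<open>-A\<close>: elsewhere the event contains an interval that is at
  least as long and whose centre is at least as close to \<open>0\<close>. The same comparison shows that, for
  fixed \<open>A + B\<close>, a positive infimum is largest exactly when \<open>A = B\<close>, and it then increases strictly
  with \<open>A + B\<close>.
\<close>

section \<open>The standard normal distribution\<close>

lemma Phi_eq_cdf: "Phi = cdf std_normal_distribution"
  by (simp add: Phi_def cdf_def2 fun_eq_iff)

interpretation std_normal: real_distribution std_normal_distribution
  by (rule real_dist_normal_dist)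

lemma std_normal_measure_singleton: "measure std_normal_distribution {x} = 0"
proof -
  have "AE y in lborel. y \<in> {x} \<longrightarrow> ennreal (std_normal_density y) = 0"
    using AE_lborel_singleton[of x] by (rule AE_mp) auto
  then have "{x} \<in> null_sets std_normal_distribution"
    by (subst null_sets_density_iff) auto
  then show ?thesis by (simp add: measure_eq_0_null_sets)
qed

lemma std_normal_measure_Ioc:
  "a \<le> b \<Longrightarrow> measure std_normal_distribution {a<..b} = Phi b - Phi a"
  using std_normal.cdf_diff_eq[of a b] by (cases "a = b") (auto simp: Phi_eq_cdf)

lemma std_normal_measure_Icc:
  assumes "a \<le> b"
  shows "measure std_normal_distribution {a..b} = Phi b - Phi a"
proof -
  have "{a..b} = {a} \<union> {a<..b}" using assms by auto
  moreover have "measure std_normal_distribution ({a} \<union> {a<..b}) =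
      measure std_normal_distribution {a} + measure std_normal_distribution {a<..b}"
    by (rule std_normal.finite_measure_Union) auto
  ultimately show ?thesis using assms std_normal_measure_Ioc std_normal_measure_singleton by simp
qed

lemma std_normal_measure_Ioo:
  assumes "a < b"
  shows "measure std_normal_distribution {a<..<b} = Phi b - Phi a"
proof -
  have "{a<..b} = {b} \<union> {a<..<b}" using assms by auto
  moreover have "measure std_normal_distribution ({b} \<union> {a<..<b}) =
      measure std_normal_distribution {b} + measure std_normal_distribution {a<..<b}"
    by (rule std_normal.finite_measure_Union) auto
  ultimately show ?thesis using assms std_normal_measure_Ioc[of a b] std_normal_measure_singleton[of b] by simp
qed

lemma isCont_Phi: "isCont Phi x"
  using std_normal.isCont_cdf std_normal_measure_singleton by (simp add: Phi_eq_cdf)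

lemma continuous_on_Phi: "continuous_on S f \<Longrightarrow> continuous_on S (\<lambda>x. Phi (f x))"
  using continuous_on_compose2[of UNIV Phi S f]
  by (simp add: continuous_at_imp_continuous_on isCont_Phi)

lemma Phi_mono: "x \<le> y \<Longrightarrow> Phi x \<le> Phi y"
  by (simp add: Phi_eq_cdf std_normal.cdf_nondecreasing)

lemma Phi_at_top: "(Phi \<longlongrightarrow> 1) at_top"
  using std_normal.cdf_lim_at_top_prob by (simp add: Phi_eq_cdf)

lemma Phi_at_bot: "(Phi \<longlongrightarrow> 0) at_bot"
  using std_normal.cdf_lim_at_bot by (simp add: Phi_eq_cdf)

text \<open>Near \<open>x\<close>, \<open>Phi\<close> is a constant plus the integral of the density
  from \<open>x - 1\<close>, so the fundamental theorem of calculus applies. The base point only has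
  to lie to the left of \<open>x\<close>, so that \<open>x\<close> is interior.\<close>

lemma Phi_has_field_derivative:
  "(Phi has_field_derivative std_normal_density x) (at x)"
proof -
  let ?f = "\<lambda>x::real. std_normal_density x"
  have cont: "continuous_on S ?f" for S
    unfolding normal_density_def by (intro continuous_intros) auto
  have eq: "Phi y = Phi (x - 1) + integral {x-1..y} ?f" if "x - 1 \<le> y" for y
  proof -
    have "set_integrable lborel {x-1..y} ?f"
      by (rule borel_integrable_atLeastAtMost') (rule cont)
    then have "integral {x-1..y} ?f = (LINT t:{x-1..y}|lborel. ?f t)"
      by (simp add: set_borel_integral_eq_integral(2))
    also have "\<dots> = (\<integral>t. indicator {x-1..y} t \<partial>std_normal_distribution)"
      unfolding set_lebesgue_integral_def by (subst integral_density) (auto simp: mult.commute)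
    also have "\<dots> = measure std_normal_distribution {x-1..y}" by simp
    finally show ?thesis using that by (simp add: std_normal_measure_Icc)
  qed
  have "((\<lambda>y. integral {x-1..y} ?f) has_field_derivative ?f x) (at x within {x-1..x+1})"
    using integral_has_real_derivative[OF cont, of x "x-1" "x+1"] by simp
  then have "((\<lambda>y. integral {x-1..y} ?f) has_field_derivative ?f x) (at x)"
    by (simp add: at_within_interior[of x "{x-1..x+1}"])
  then have "((\<lambda>y. Phi (x - 1) + integral {x-1..y} ?f) has_field_derivative ?f x) (at x)"
    by (auto intro!: derivative_eq_intros)
  then show ?thesis
    by (rule has_field_derivative_transform_within_open[where S = "{x-1<..}"]) (auto simp: eq[symmetric])
qed

text \<open>The density is even, so \<open>Phi x + Phi (- x)\<close> has derivative 0 and is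
  constant; its limit at infinity is 1.\<close>

lemma Phi_uminus: "Phi (- x) = 1 - Phi x"
proof -
  have *: "((\<lambda>x. Phi x + Phi (- x)) has_field_derivative 0) (at y)" for y
    using DERIV_add[OF Phi_has_field_derivative[of y]
        DERIV_chain2[OF Phi_has_field_derivative DERIV_minus[OF DERIV_ident]]]
    by (simp add: std_normal_density_def)
  have const: "(\<lambda>y. Phi y + Phi (- y)) = (\<lambda>_. Phi x + Phi (- x))"
    by (rule ext, rule DERIV_isconst_all) (use * in blast)
  have "((\<lambda>y. Phi y + Phi (- y)) \<longlongrightarrow> 1 + 0) at_top"
    by (intro tendsto_add Phi_at_top filterlim_compose[OF Phi_at_bot] filterlim_uminus_at_bot_at_top)
  moreover have "((\<lambda>y. Phi y + Phi (- y)) \<longlongrightarrow> Phi x + Phi (- x)) at_top"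
    unfolding const by (rule tendsto_const)
  ultimately have "1 + 0 = Phi x + Phi (- x)"
    by (rule tendsto_unique[OF trivial_limit_at_top_linorder])
  then show ?thesis by simp
qed

definition central :: "real \<Rightarrow> real \<Rightarrow> real"
  where "central c r = Phi (c + r) - Phi (c - r)"

lemma central_abs: "central \<bar>c\<bar> r = central c r"
proof -
  have "central (- c) r = central c r"
    using Phi_uminus[of "c + r"] Phi_uminus[of "c - r"] by (simp add: central_def)
  then show ?thesis by (simp add: abs_if)
qed

lemma Phi_strict_mono: assumes "x < y" shows "Phi x < Phi y"
  by (rule DERIV_pos_imp_increasing[OF assms])
    (use Phi_has_field_derivative normal_density_pos[of 1 0] in auto)

text \<open>The derivative in \<open>c\<close> is the density at \<open>c + r\<close> minus the
  density at \<open>c - r\<close>, which is negative for positive \<open>c\<close> and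
  \<open>r\<close> because |c - r| < c + r. It vanishes at \<open>c = 0\<close>, hence the criterion
  that asks for a negative derivative in the open interval only.\<close>

lemma central_strict_antimono_center:
  assumes "0 \<le> c" "c < c'" "0 < r"
  shows "central c' r < central c r"
proof (rule DERIV_neg_imp_decreasing_open[OF assms(2), of "\<lambda>c. central c r"])
  fix x assume x: "c < x" "x < c'"
  have "(x - r)\<^sup>2 < (x + r)\<^sup>2" using x assms by (simp add: power2_eq_square algebra_simps)
  then have "std_normal_density (x + r) < std_normal_density (x - r)"
    by (simp add: std_normal_density_def divide_strict_right_mono)
  moreover have "((\<lambda>c. central c r) has_field_derivative
      std_normal_density (x + r) - std_normal_density (x - r)) (at x)"
    unfolding central_def
    using DERIV_diff[OF
        DERIV_chain2[OF Phi_has_field_derivative DERIV_add[OF DERIV_ident DERIV_const]]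
        DERIV_chain2[OF Phi_has_field_derivative DERIV_diff[OF DERIV_ident DERIV_const]]]
    by simp
  ultimately show "\<exists>y. ((\<lambda>c. central c r) has_real_derivative y) (at x) \<and> y < 0"
    by (intro exI conjI) auto
next
  show "continuous_on {c..c'} (\<lambda>c. central c r)"
    unfolding central_def
    by (rule continuous_on_diff; rule continuous_on_Phi; intro continuous_intros)
qed

text \<open>First the centre moves towards 0, then the radius grows; neither step loses probability.
  The lower bounds on coverage and the optimality of symmetric intervals both rest on this
  comparison.\<close>

lemma central_mono:
  assumes "0 \<le> r" "r \<le> r'" "\<bar>c'\<bar> \<le> \<bar>c\<bar>"
  shows "central c r \<le> central c' r'"
proof -
  have "central \<bar>c\<bar> r \<le> central \<bar>c'\<bar> r"
    using central_strict_antimono_center[of "\<bar>c'\<bar>" "\<bar>c\<bar>" r] assms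
    by (cases "\<bar>c'\<bar> = \<bar>c\<bar>"; cases "r = 0") (auto simp: central_def)
  also have "\<dots> \<le> central \<bar>c'\<bar> r'"
    unfolding central_def by (rule diff_mono[OF Phi_mono Phi_mono]) (use assms in auto)
  finally show ?thesis by (simp add: central_abs)
qed

lemma central_strict_mono_radius: "r < r' \<Longrightarrow> central c r < central c r'"
  unfolding central_def by (rule diff_strict_mono[OF Phi_strict_mono Phi_strict_mono]) auto

lemma central_nonpos: "r \<le> 0 \<Longrightarrow> central c r \<le> 0"
  unfolding central_def by (simp add: Phi_mono)

lemma Phi_diff_eq_central: "Phi u - Phi l = central ((l + u) / 2) ((u - l) / 2)"
  by (simp add: central_def field_simps)

text \<open>This is \<open>central_mono\<close> in terms of endpoints: \<open>u - l\<close> is twice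
  the radius and \<open>l + u\<close> twice the centre.\<close>

lemma Phi_diff_le:
  assumes "l \<le> u" "u - l \<le> u' - l'" "\<bar>l' + u'\<bar> \<le> \<bar>l + u\<bar>"
  shows "Phi u - Phi l \<le> Phi u' - Phi l'"
proof -
  have "\<bar>(l' + u') / 2\<bar> \<le> \<bar>(l + u) / 2\<bar>" using assms by simp
  then show ?thesis
    unfolding Phi_diff_eq_central by (intro central_mono) (use assms in auto)
qed

section \<open>The law of the least squares estimator\<close>

text \<open>Both the density and the indicator of a box are products over the coordinates, so the
  Lebesgue integral factorises.\<close>

lemma emeasure_reg_model_prod:
  fixes X :: "real^'k^'n" and A :: "'n \<Rightarrow> real set"
  assumes [measurable]: "\<And>j. A j \<in> sets borel"
  shows "emeasure (reg_model X \<theta> \<sigma>) {y. \<forall>j. y $ j \<in> A j} =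
    (\<Prod>j\<in>UNIV. \<integral>\<^sup>+t. ennreal (normal_density ((X *v \<theta>) $ j) \<sigma> t) * indicator (A j) t \<partial>lborel)"
proof -
  let ?\<mu> = "\<lambda>j. (X *v \<theta>) $ j"
  let ?f = "\<lambda>j t. ennreal (normal_density (?\<mu> j) \<sigma> t) * indicator (A j) t"
  have basis: "Basis = range (\<lambda>j::'n. axis j (1::real))"
    by (auto simp: Basis_vec_def)
  have inj: "inj (\<lambda>j::'n. axis j (1::real))" by (simp add: inj_on_def axis_eq_axis)
  \<comment> \<open>\<open>g\<close> indexes the factors by basis vectors instead of coordinates,
    the form in which \<open>nn_integral_lborel_prod\<close> factorises the integral.\<close>
  define g where "g b = ?f (inv (\<lambda>j::'n. axis j (1::real)) b)" for b
  have g: "g (axis j 1) = ?f j" for j by (simp add: g_def inv_f_f[OF inj])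
  have [measurable]: "{y::real^'n. \<forall>j. y $ j \<in> A j} \<in> sets borel"
    by measurable
  have "emeasure (reg_model X \<theta> \<sigma>) {y. \<forall>j. y $ j \<in> A j} =
      (\<integral>\<^sup>+y. ennreal (\<Prod>j\<in>UNIV. normal_density (?\<mu> j) \<sigma> (y $ j)) *
        indicator {y. \<forall>j. y $ j \<in> A j} y \<partial>lborel)"
    unfolding reg_model_def by (rule emeasure_density) auto
  also have "\<dots> = (\<integral>\<^sup>+y. (\<Prod>j\<in>UNIV. ?f j (y $ j)) \<partial>lborel)"
  proof (rule nn_integral_cong)
    fix y :: "real^'n"
    have "indicator {y. \<forall>j. y $ j \<in> A j} y = (\<Prod>j\<in>UNIV. indicator (A j) (y $ j) :: ennreal)"
      by (auto simp: indicator_def prod_zero_iff)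
    then show "ennreal (\<Prod>j\<in>UNIV. normal_density (?\<mu> j) \<sigma> (y $ j)) *
        indicator {y. \<forall>j. y $ j \<in> A j} y = (\<Prod>j\<in>UNIV. ?f j (y $ j))"
      by (simp add: prod.distrib prod_ennreal)
  qed
  also have "\<dots> = (\<integral>\<^sup>+y. (\<Prod>b\<in>Basis. g b (y \<bullet> b)) \<partial>lborel)"
    by (simp add: basis prod.reindex[OF inj] g cart_eq_inner_axis)
  also have "\<dots> = (\<Prod>b\<in>Basis. \<integral>\<^sup>+t. g b t \<partial>lborel)"
    by (rule nn_integral_lborel_prod) (auto simp: basis g)
  also have "\<dots> = (\<Prod>j\<in>UNIV. \<integral>\<^sup>+t. ?f j t \<partial>lborel)"
    by (simp add: basis prod.reindex[OF inj] g)
  finally show ?thesis .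
qed

lemma space_reg_model [simp]: "space (reg_model X \<theta> \<sigma>) = UNIV"
  and sets_reg_model [simp, measurable_cong]: "sets (reg_model X \<theta> \<sigma>) = sets borel"
  by (simp_all add: reg_model_def)

lemma nn_integral_normal_density:
  assumes "0 < \<sigma>"
  shows "(\<integral>\<^sup>+t. ennreal (normal_density \<mu> \<sigma> t) \<partial>lborel) = 1"
  using prob_space.emeasure_space_1[OF prob_space_normal_density[OF assms, of \<mu>]]
  by (simp add: emeasure_density)

lemma prob_space_reg_model:
  assumes "0 < \<sigma>"
  shows "prob_space (reg_model X \<theta> \<sigma>)"
  using emeasure_reg_model_prod[of "\<lambda>_. UNIV" X \<theta> \<sigma>] assms
  by (intro prob_spaceI) (simp add: nn_integral_normal_density)

text \<open>Coordinates outside \<open>J\<close> are left unrestricted and contribute a factor 1,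
  the total mass of a normal density.\<close>

lemma emeasure_reg_model_coords:
  fixes X :: "real^'k^'n" and A :: "'n \<Rightarrow> real set"
  assumes \<sigma>: "0 < \<sigma>" and A: "\<And>j. j \<in> J \<Longrightarrow> A j \<in> sets borel"
  shows "emeasure (reg_model X \<theta> \<sigma>) {y. \<forall>j\<in>J. y $ j \<in> A j} =
    (\<Prod>j\<in>J. \<integral>\<^sup>+t. ennreal (normal_density ((X *v \<theta>) $ j) \<sigma> t) * indicator (A j) t \<partial>lborel)"
proof -
  let ?A = "\<lambda>j. if j \<in> J then A j else UNIV"
  have "{y. \<forall>j\<in>J. y $ j \<in> A j} = {y. \<forall>j. y $ j \<in> ?A j}" by auto
  also have "emeasure (reg_model X \<theta> \<sigma>) \<dots> = (\<Prod>j\<in>UNIV. \<integral>\<^sup>+t. ennreal (normal_density ((X *v \<theta>) $ j) \<sigma> t) * indicator (?A j) t \<partial>lborel)"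
    by (rule emeasure_reg_model_prod) (use A in auto)
  also have "\<dots> = (\<Prod>j\<in>J. \<integral>\<^sup>+t. ennreal (normal_density ((X *v \<theta>) $ j) \<sigma> t) * indicator (?A j) t \<partial>lborel)"
    by (rule prod.mono_neutral_right) (auto simp: nn_integral_normal_density[OF \<sigma>])
  finally show ?thesis by (simp cong: prod.cong)
qed

lemma distributed_reg_model_coord:
  assumes \<sigma>: "0 < \<sigma>"
  shows "distributed (reg_model X \<theta> \<sigma>) lborel (\<lambda>y. y $ j) (normal_density ((X *v \<theta>) $ j) \<sigma>)"
  unfolding distributed_def
proof (intro conjI)
  show "distr (reg_model X \<theta> \<sigma>) lborel (\<lambda>y. y $ j) =
      density lborel (\<lambda>x. ennreal (normal_density ((X *v \<theta>) $ j) \<sigma> x))"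
  proof (rule measure_eqI)
    fix A :: "real set" assume "A \<in> sets (distr (reg_model X \<theta> \<sigma>) lborel (\<lambda>y. y $ j))"
    then have A[measurable]: "A \<in> sets borel" by simp
    have "emeasure (distr (reg_model X \<theta> \<sigma>) lborel (\<lambda>y. y $ j)) A =
        emeasure (reg_model X \<theta> \<sigma>) {y. \<forall>j\<in>{j}. y $ j \<in> A}"
      by (subst emeasure_distr) (auto simp: vimage_def)
    also have "\<dots> = emeasure (density lborel (\<lambda>x. ennreal (normal_density ((X *v \<theta>) $ j) \<sigma> x))) A"
      by (subst emeasure_reg_model_coords[OF \<sigma>]) (auto simp: emeasure_density)
    finally show "emeasure (distr (reg_model X \<theta> \<sigma>) lborel (\<lambda>y. y $ j)) A =
      emeasure (density lborel (\<lambda>x. ennreal (normal_density ((X *v \<theta>) $ j) \<sigma> x))) A" .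
  qed simp
qed auto

text \<open>The events generated by a coordinate restrict it to a Borel set, so independence is the
  product formula for boxes compared with its one-coordinate instances.\<close>

lemma indep_vars_reg_model_coord:
  fixes X :: "real^'k^'n"
  assumes \<sigma>: "0 < \<sigma>"
  shows "prob_space.indep_vars (reg_model X \<theta> \<sigma>) (\<lambda>_. borel) (\<lambda>j y. y $ j) UNIV"
proof -
  interpret prob_space "reg_model X \<theta> \<sigma>" by (rule prob_space_reg_model[OF \<sigma>])
  show ?thesis
    unfolding indep_vars_def2
  proof (intro conjI ballI indep_setsI)
    fix j show "random_variable borel (\<lambda>y. y $ j)" by measurable
  next
    fix j show "{(\<lambda>y. y $ j) -` A \<inter> space (reg_model X \<theta> \<sigma>) |A. A \<in> sets borel} \<subseteq> events"
      using measurable_sets[of "\<lambda>y. y $ j" "reg_model X \<theta> \<sigma>" borel] by auto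
  next
    fix B :: "'n \<Rightarrow> (real^'n) set" and J :: "'n set"
    assume "J \<noteq> {}" "J \<subseteq> UNIV" "finite J"
      and B: "\<forall>j\<in>J. B j \<in> {(\<lambda>y. y $ j) -` A \<inter> space (reg_model X \<theta> \<sigma>) |A. A \<in> sets borel}"
    then obtain A where A: "\<And>j. j \<in> J \<Longrightarrow> A j \<in> sets borel" "\<And>j. j \<in> J \<Longrightarrow> B j = {y. y $ j \<in> A j}"
      by (force simp: vimage_def Bex_def dest!: bchoice)
    have one: "emeasure (reg_model X \<theta> \<sigma>) {y. y $ j \<in> A j} =
        (\<integral>\<^sup>+t. ennreal (normal_density ((X *v \<theta>) $ j) \<sigma> t) * indicator (A j) t \<partial>lborel)"
      if "j \<in> J" for j
      using emeasure_reg_model_coords[OF \<sigma>, of "{j}" A X \<theta>] A(1) that by simp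
    have "emeasure (reg_model X \<theta> \<sigma>) (\<Inter> (B ` J)) = emeasure (reg_model X \<theta> \<sigma>) {y. \<forall>j\<in>J. y $ j \<in> A j}"
      by (rule arg_cong[where f="emeasure _"]) (auto simp: A)
    also have "\<dots> = (\<Prod>j\<in>J. emeasure (reg_model X \<theta> \<sigma>) {y. \<forall>j\<in>{j}. y $ j \<in> A j})"
      by (subst emeasure_reg_model_coords[OF \<sigma>, of J A])
        (simp_all add: A(1) one)
    also have "\<dots> = (\<Prod>j\<in>J. emeasure (reg_model X \<theta> \<sigma>) (B j))"
      by (rule prod.cong) (auto simp: A)
    finally show "prob (\<Inter> (B ` J)) = (\<Prod>j\<in>J. prob (B j))"
      by (simp add: emeasure_eq_measure prod_ennreal prod_nonneg)
  qed
qed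

lemma distributed_reg_model_linear:
  fixes X :: "real^'k^'n"
  assumes \<sigma>: "0 < \<sigma>" and c: "c \<noteq> 0"
  shows "distributed (reg_model X \<theta> \<sigma>) lborel (\<lambda>y. c \<bullet> y) (normal_density (c \<bullet> (X *v \<theta>)) (\<sigma> * norm c))"
proof -
  interpret prob_space "reg_model X \<theta> \<sigma>" by (rule prob_space_reg_model[OF \<sigma>])
  \<comment> \<open>Coordinates with coefficient 0 are dropped, since their contribution would be
    normal with standard deviation 0; the inner product is unaffected. The leading
    \<open>0 +\<close> in the summands matches the form of
    \<open>normal_density_affine\<close>.\<close>
  define J where "J = {j. c $ j \<noteq> 0}"
  have "J \<noteq> {}" using c by (auto simp: J_def vec_eq_iff)
  have "indep_vars (\<lambda>_. borel) (\<lambda>j y. 0 + c $ j * y $ j) J"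
    using indep_vars_compose2[OF indep_vars_subset[OF indep_vars_reg_model_coord[OF \<sigma>, of X \<theta>] subset_UNIV[of J]],
        of "\<lambda>j t. 0 + c $ j * t" "\<lambda>_. borel"] by simp
  moreover have "distributed (reg_model X \<theta> \<sigma>) lborel (\<lambda>y. 0 + c $ j * y $ j)
      (normal_density (0 + c $ j * (X *v \<theta>) $ j) (\<bar>c $ j\<bar> * \<sigma>))" if "j \<in> J" for j
    by (rule normal_density_affine[OF distributed_reg_model_coord]) (use \<sigma> that in \<open>auto simp: J_def\<close>)
  ultimately have *: "distributed (reg_model X \<theta> \<sigma>) lborel (\<lambda>y. \<Sum>j\<in>J. 0 + c $ j * y $ j)
      (normal_density (\<Sum>j\<in>J. 0 + c $ j * (X *v \<theta>) $ j) (sqrt (\<Sum>j\<in>J. (\<bar>c $ j\<bar> * \<sigma>)\<^sup>2)))"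
    using \<open>J \<noteq> {}\<close> \<sigma> by (intro sum_indep_normal) (auto simp: J_def)
  have J: "(\<Sum>j\<in>J. 0 + c $ j * y $ j) = c \<bullet> y" for y
    unfolding inner_vec_def by (simp, rule sum.mono_neutral_left) (auto simp: J_def)
  have "(\<Sum>j\<in>J. (\<bar>c $ j\<bar> * \<sigma>)\<^sup>2) = (\<Sum>j\<in>UNIV. (c $ j)\<^sup>2 * \<sigma>\<^sup>2)"
    by (simp add: power_mult_distrib, rule sum.mono_neutral_left) (auto simp: J_def)
  also have "\<dots> = (\<sigma> * norm c)\<^sup>2"
    by (simp add: power_mult_distrib norm_vec_def L2_set_def sum_nonneg sum_distrib_left mult.commute)
  finally have "sqrt (\<Sum>j\<in>J. (\<bar>c $ j\<bar> * \<sigma>)\<^sup>2) = \<sigma> * norm c"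
    using \<sigma> by simp
  with * show ?thesis by (simp only: J)
qed

text \<open>Standardisation: the linear functional, centred at its mean and divided by its standard
  deviation, is standard normal, and \<open>w\<close> stands for that standardised variable.\<close>

lemma measure_reg_model_linear:
  fixes X :: "real^'k^'n"
  assumes \<sigma>: "0 < \<sigma>" and c: "c \<noteq> 0" and P: "Measurable.pred borel P"
  shows "measure (reg_model X \<theta> \<sigma>) {y. P (c \<bullet> y)} =
    measure std_normal_distribution {w. P (c \<bullet> (X *v \<theta>) + \<sigma> * norm c * w)}"
proof -
  interpret prob_space "reg_model X \<theta> \<sigma>" by (rule prob_space_reg_model[OF \<sigma>])
  define \<mu> \<tau> where "\<mu> = c \<bullet> (X *v \<theta>)" and "\<tau> = \<sigma> * norm c"
  have \<tau>: "0 < \<tau>" using \<sigma> c by (simp add: \<tau>_def)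
  have D: "distributed (reg_model X \<theta> \<sigma>) lborel (\<lambda>y. (c \<bullet> y - \<mu>) / \<tau>) std_normal_density"
    using distributed_reg_model_linear[OF \<sigma> c, of X \<theta>] normal_standard_normal_convert[OF \<tau>]
    by (simp add: \<mu>_def \<tau>_def)
  have [measurable]: "{w. P (\<mu> + \<tau> * w)} \<in> sets borel" using P by measurable
  have "measure std_normal_distribution {w. P (\<mu> + \<tau> * w)} =
      measure (distr (reg_model X \<theta> \<sigma>) lborel (\<lambda>y. (c \<bullet> y - \<mu>) / \<tau>)) {w. P (\<mu> + \<tau> * w)}"
    using distributed_distr_eq_density[OF D] by simp
  also have "\<dots> = measure (reg_model X \<theta> \<sigma>) {y. P (c \<bullet> y)}"
    using \<tau> by (subst measure_distr) (auto simp: vimage_def)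
  finally show ?thesis by (simp add: \<mu>_def \<tau>_def)
qed

section \<open>The Gram matrix and least squares components as linear functionals\<close>

lemma matrix_inv_unique:
  fixes A :: "'a::semiring_1^'n^'n"
  assumes "A ** B = mat 1" "B ** A = mat 1"
  shows "matrix_inv A = B"
proof -
  have "A ** matrix_inv A = mat 1 \<and> matrix_inv A ** A = mat 1"
    unfolding matrix_inv_def by (rule someI[of _ B]) (use assms in auto)
  then show ?thesis using assms by (metis matrix_mul_assoc matrix_mul_lid matrix_mul_rid)
qed

context
  fixes X :: "real^'k^'n"
  assumes rank: "rank X = CARD('k)"
begin

text \<open>If the Gram matrix annihilates \<open>v\<close>, then |X v|^2 = v \<bullet> X'X v = 0,
  and \<open>v = 0\<close> because full column rank makes \<open>X\<close> injective.\<close>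

lemma gram_invertible: "invertible (transpose X ** X)"
proof -
  have inj: "inj ((*v) X)" using rank full_rank_injective by blast
  have "v = 0" if "(transpose X ** X) *v v = 0" for v
  proof -
    have "(X *v v) \<bullet> (X *v v) = v \<bullet> (transpose X *v (X *v v))"
      by (simp add: dot_lmul_matrix[symmetric] inner_commute)
    also have "\<dots> = 0" using that by (simp add: matrix_vector_mul_assoc)
    finally have "X *v v = X *v 0" by simp
    then show ?thesis using inj by (metis injD)
  qed
  then show ?thesis
    unfolding invertible_left_inverse matrix_left_invertible_ker by blast
qed

lemma gram_inv:
  "matrix_inv (transpose X ** X) ** (transpose X ** X) = mat 1"
  "(transpose X ** X) ** matrix_inv (transpose X ** X) = mat 1"
  using gram_invertible matrix_inv_unique unfolding invertible_def by metis+

definition ls_row :: "'k \<Rightarrow> real^'n"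
  where "ls_row i = (matrix_inv (transpose X ** X) ** transpose X) $ i"

lemma ls_est_eq: "ls_est X y $ i = ls_row i \<bullet> y"
  by (simp add: ls_est_def ls_row_def matrix_vector_mul_assoc del: transpose_matrix_vector)
    (simp add: matrix_vector_mul_component)

text \<open>Unbiasedness: the matrix whose rows are \<open>ls_row i\<close> is a left inverse of
  \<open>X\<close>.\<close>

lemma ls_row_model: "ls_row i \<bullet> (X *v \<theta>) = \<theta> $ i"
  using gram_inv(1)
  by (simp add: ls_est_eq[symmetric] ls_est_def matrix_vector_mul_assoc matrix_mul_assoc)

lemma ls_row_nonzero: "ls_row i \<noteq> 0"
  using ls_row_model[of i "axis i 1"] by auto

text \<open>As the inverse Gram matrix is symmetric, (X'X)^-1 X' times its own transpose is
  (X'X)^-1, so its \<open>i\<close>-th diagonal entry is the squared norm of the row. The scaling of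
  the Gram matrix inside \<open>xi\<close> accounts for the factor \<open>sqrt n\<close>.\<close>

lemma norm_ls_row: "norm (ls_row i) = xi X i / sqrt (real CARD('n))"
proof -
  let ?M = "transpose X ** X" and ?n = "real CARD('n)"
  let ?I = "matrix_inv ?M"
  have "transpose ?I = ?I"
  proof -
    have "transpose (?M ** ?I) = mat 1" by (simp add: gram_inv)
    then have "transpose ?I ** ?M = mat 1"
      by (simp add: matrix_transpose_mul)
    then show ?thesis
      by (metis gram_inv(2) matrix_mul_assoc matrix_mul_lid matrix_mul_rid)
  qed
  then have "(?I ** transpose X) ** transpose (?I ** transpose X) = ?I"
    by (metis gram_inv(1) matrix_mul_assoc matrix_mul_lid matrix_transpose_mul transpose_transpose)
  moreover have "((?I ** transpose X) ** transpose (?I ** transpose X)) $ i $ i = ls_row i \<bullet> ls_row i"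
    by (simp add: ls_row_def matrix_matrix_mult_def transpose_def inner_vec_def)
  ultimately have 1: "?I $ i $ i = (norm (ls_row i))\<^sup>2"
    by (simp add: power2_norm_eq_inner)
  have "matrix_inv (inverse ?n *\<^sub>R ?M) = ?n *\<^sub>R ?I"
    by (rule matrix_inv_unique)
      (simp_all add: scalar_matrix_assoc[symmetric] matrix_scalar_ac gram_inv)
  then have "xi X i = sqrt (?n * (norm (ls_row i))\<^sup>2)"
    by (simp add: xi_def 1)
  then show ?thesis by (simp add: real_sqrt_mult)
qed

lemma xi_pos: "0 < xi X i"
proof -
  have "0 < xi X i / sqrt (real CARD('n))"
    using ls_row_nonzero[of i] by (simp flip: norm_ls_row)
  then show ?thesis by (simp add: zero_less_divide_iff)
qed

lemma measure_ls_est: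
  assumes "0 < \<sigma>" "Measurable.pred borel P"
  shows "measure (reg_model X \<theta> \<sigma>) {y. P (ls_est X y $ i)} =
    measure std_normal_distribution {w. P (\<theta> $ i + \<sigma> * xi X i / sqrt (real CARD('n)) * w)}"
  using measure_reg_model_linear[OF assms(1) ls_row_nonzero assms(2), where X = X and \<theta> = \<theta>]
  by (simp add: ls_est_eq ls_row_model norm_ls_row)

end

section \<open>Infimal coverage of the rescaled problem\<close>

text \<open>Endpoints have mass 0, so the open interval is all that has to be contained in
  \<open>E\<close>. For \<open>u \<le> l\<close> the left side is nonpositive, which spares a
  nonemptiness condition later.\<close>

lemma Phi_diff_le_measure:
  assumes [measurable]: "E \<in> sets borel" and "{l<..<u} \<subseteq> E"
  shows "Phi u - Phi l \<le> measure std_normal_distribution E"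
proof (cases "l < u")
  case True
  have "measure std_normal_distribution {l<..<u} \<le> measure std_normal_distribution E"
    by (rule std_normal.finite_measure_mono) (use assms in auto)
  with True show ?thesis by (simp add: std_normal_measure_Ioo)
next
  case False
  then have "Phi u - Phi l \<le> 0" by (simp add: Phi_mono)
  also have "0 \<le> measure std_normal_distribution E" by simp
  finally show ?thesis .
qed

lemma measure_le_Phi_diff:
  assumes "E \<subseteq> {l..u}"
  shows "measure std_normal_distribution E \<le> max 0 (Phi u - Phi l)"
proof (cases "l \<le> u")
  case True
  have "measure std_normal_distribution E \<le> measure std_normal_distribution {l..u}"
    by (rule std_normal.finite_measure_mono) (use assms in auto)
  with True show ?thesis by (simp add: std_normal_measure_Icc)
next
  case False
  with assms have "E = {}" by auto
  then show ?thesis by simp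
qed

text \<open>A law on the line is determined by its cdf; here the reflected cdf at \<open>x\<close>
  is the mass of \<open>{- x..}\<close>, which is \<open>1 - Phi (- x) = Phi x\<close>.\<close>

lemma distr_std_normal_uminus: "distr std_normal_distribution borel uminus = std_normal_distribution"
proof (rule cdf_unique)
  show "real_distribution (distr std_normal_distribution borel uminus)"
    by (rule std_normal.real_distribution_distr) simp
  show "real_distribution std_normal_distribution"
    by (rule real_dist_normal_dist)
  show "cdf (distr std_normal_distribution borel uminus) = cdf std_normal_distribution"
  proof
    fix x :: real
    have "cdf (distr std_normal_distribution borel uminus) x =
        measure std_normal_distribution {- x..}"
      unfolding cdf_def by (subst measure_distr) (auto intro!: arg_cong[where f="measure _"])
    also have "\<dots> = measure std_normal_distribution ({- x} \<union> (UNIV - {..- x}))"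
      by (rule arg_cong[where f="measure _"]) auto
    also have "\<dots> = measure std_normal_distribution {- x} + measure std_normal_distribution (UNIV - {..- x})"
      by (rule std_normal.finite_measure_Union) auto
    also have "\<dots> = 1 - Phi (- x)"
      using std_normal.prob_compl[of "{..- x}"]
      by (simp add: std_normal_measure_singleton Phi_eq_cdf cdf_def)
    also have "\<dots> = cdf std_normal_distribution x"
      by (simp add: Phi_uminus flip: Phi_eq_cdf)
    finally show "cdf (distr std_normal_distribution borel uminus) x = cdf std_normal_distribution x" .
  qed
qed

lemma std_normal_measure_uminus:
  assumes [measurable]: "Measurable.pred borel P"
  shows "measure std_normal_distribution {w. P (- w)} = measure std_normal_distribution {w. P w}"
proof -
  have [measurable]: "{w. P w} \<in> sets borel" by measurable
  have "measure (distr std_normal_distribution borel uminus) {w. P w} =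
      measure std_normal_distribution {w. P (- w)}"
    by (subst measure_distr) (auto simp: vimage_def)
  then show ?thesis by (simp add: distr_std_normal_uminus)
qed

text \<open>Coverage probability after rescaling to unit variance: \<open>T\<close> is the thresholding
  function and \<open>m\<close> the rescaled parameter \<open>\<theta>\<^sub>i\<close>.\<close>

definition shift_cov :: "(real \<Rightarrow> real) \<Rightarrow> real \<Rightarrow> real \<Rightarrow> real \<Rightarrow> real"
  where "shift_cov T A B m =
    measure std_normal_distribution {w. m - B \<le> T (m + w) \<and> T (m + w) \<le> m + A}"

lemma shift_cov_lower:
  assumes "T \<in> borel_measurable borel"
    and "\<And>w. l < w \<Longrightarrow> w < u \<Longrightarrow> m - B \<le> T (m + w) \<and> T (m + w) \<le> m + A"
  shows "Phi u - Phi l \<le> shift_cov T A B m"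
  unfolding shift_cov_def
proof (rule Phi_diff_le_measure)
  have [measurable]: "T \<in> borel_measurable borel" by fact
  show "{w. m - B \<le> T (m + w) \<and> T (m + w) \<le> m + A} \<in> sets borel" by measurable
qed (use assms(2) in auto)

lemma shift_cov_upper:
  assumes "\<And>w. m - B \<le> T (m + w) \<Longrightarrow> T (m + w) \<le> m + A \<Longrightarrow> l \<le> w \<and> w \<le> u"
  shows "shift_cov T A B m \<le> max 0 (Phi u - Phi l)"
  unfolding shift_cov_def by (rule measure_le_Phi_diff) (use assms in auto)

lemma shift_cov_nonneg: "0 \<le> shift_cov T A B m"
  by (simp add: shift_cov_def)

text \<open>Replacing \<open>w\<close> by \<open>- w\<close> preserves the normal law, and oddness
  of \<open>T\<close> then reflects the whole event, exchanging the two margins.\<close>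

lemma shift_cov_uminus:
  assumes [measurable]: "T \<in> borel_measurable borel" and odd: "\<And>t. T (- t) = - T t"
  shows "shift_cov T A B (- m) = shift_cov T B A m"
proof -
  have eq: "T (- m + - w) = - T (m + w)" for w
    using odd[of "m + w"] by simp
  have "shift_cov T A B (- m) =
      measure std_normal_distribution {w. - m - B \<le> T (- m + - w) \<and> T (- m + - w) \<le> - m + A}"
    unfolding shift_cov_def
    by (rule std_normal_measure_uminus[symmetric]) measurable
  also have "\<dots> = shift_cov T B A m"
    unfolding shift_cov_def eq by (rule arg_cong[where f="measure _"]) auto
  finally show ?thesis .
qed

lemma INF_shift_cov_swap:
  assumes "T \<in> borel_measurable borel" "\<And>t. T (- t) = - T t"
  shows "(INF m. shift_cov T A B m) = (INF m. shift_cov T B A m)"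
proof -
  have "range (\<lambda>m. shift_cov T A B (- m)) = shift_cov T A B ` range uminus"
    by (simp only: image_image)
  then show ?thesis by (simp add: shift_cov_uminus[OF assms])
qed

text \<open>The infimum need not be attained: \<open>g \<epsilon>\<close> is a family of points
  along which the values approach it as \<open>\<epsilon>\<close> decreases to 0.\<close>

lemma INF_eq_if_bounds:
  fixes f :: "'a \<Rightarrow> real" and h :: "real \<Rightarrow> real"
  assumes lower: "\<And>m. v \<le> f m"
    and upper: "\<And>\<epsilon>. 0 < \<epsilon> \<Longrightarrow> f (g \<epsilon>) \<le> h \<epsilon>"
    and lim: "(h \<longlongrightarrow> v) (at_right 0)"
  shows "(INF m. f m) = v"
proof (rule antisym)
  have "bdd_below (range f)" by (rule bdd_belowI2[of _ v]) (use lower in auto)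
  then have "(INF m. f m) \<le> h \<epsilon>" if "0 < \<epsilon>" for \<epsilon>
    using upper[OF that] by (meson UNIV_I cINF_lower order_trans)
  then have "eventually (\<lambda>\<epsilon>. (INF m. f m) \<le> h \<epsilon>) (at_right 0)"
    by (auto simp: eventually_at_filter)
  then show "(INF m. f m) \<le> v"
    by (rule tendsto_lowerbound[OF lim]) simp_all
  show "v \<le> (INF m. f m)" by (rule cINF_greatest) (use lower in auto)
qed

lemma tendsto_max_Phi_diff:
  assumes "isCont u 0" "isCont l 0"
  shows "((\<lambda>\<epsilon>. max 0 (Phi (u \<epsilon>) - Phi (l \<epsilon>))) \<longlongrightarrow> max 0 (Phi (u 0) - Phi (l 0))) (at_right 0)"
proof -
  have "isCont (\<lambda>\<epsilon>. max 0 (Phi (u \<epsilon>) - Phi (l \<epsilon>))) 0"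
    by (rule continuous_max[OF continuous_const continuous_diff[OF
          isCont_o2[OF assms(1) isCont_Phi] isCont_o2[OF assms(2) isCont_Phi]]])
  then show ?thesis
    unfolding isCont_def by (rule filterlim_mono[OF _ order_refl at_le]) simp
qed

text \<open>In the applications \<open>p\<close> is a coverage probability bounded below by an
  interval at least as long and at least as central as the one from \<open>l\<close> to
  \<open>u\<close>. If \<open>l > u\<close>, the truncated difference is 0.\<close>

lemma Phi_diff_le_if:
  assumes "u - l \<le> u' - l'" "\<bar>l' + u'\<bar> \<le> \<bar>l + u\<bar>" "Phi u' - Phi l' \<le> p" "0 \<le> p"
  shows "max 0 (Phi u - Phi l) \<le> p"
proof (cases "l \<le> u")
  case True
  then show ?thesis using Phi_diff_le[of l u u' l'] assms by simp
next
  case False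
  then have "Phi u \<le> Phi l" by (simp add: Phi_mono)
  then show ?thesis using assms by simp
qed

section \<open>Hard thresholding\<close>

definition hard_thr :: "real \<Rightarrow> real \<Rightarrow> real"
  where "hard_thr \<eta> t = (if \<bar>t\<bar> > \<eta> then t else 0)"

lemma hard_thr_measurable: "hard_thr \<eta> \<in> borel_measurable borel"
  unfolding hard_thr_def by measurable

lemma hard_thr_odd: "hard_thr \<eta> (- t) = - hard_thr \<eta> t"
  by (simp add: hard_thr_def)

lemma INF_shift_cov_hard:
  assumes "0 < \<eta>" "0 \<le> A" "A \<le> B"
  shows "(INF m. shift_cov (hard_thr \<eta>) A B m) = max 0 (Phi (A - \<eta>) - Phi (- B))"
proof (rule INF_eq_if_bounds)
  note lower = shift_cov_lower[OF hard_thr_measurable]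
  fix m
  consider "m < - A" | "- A \<le> m" "m \<le> B" | "B < m" by linarith
  then show "max 0 (Phi (A - \<eta>) - Phi (- B)) \<le> shift_cov (hard_thr \<eta>) A B m"
  proof cases
    case 1
    \<comment> \<open>Here \<open>m + A < 0\<close>, so the value 0 is not covered; but
      \<open>w < A - \<eta>\<close> gives \<open>m + w < - \<eta>\<close>, where no thresholding
      takes place.\<close>
    have "Phi (A - \<eta>) - Phi (- B) \<le> shift_cov (hard_thr \<eta>) A B m"
      by (rule lower) (use 1 assms in \<open>auto simp: hard_thr_def\<close>)
    then show ?thesis by (simp add: shift_cov_nonneg)
  next
    case 2
    \<comment> \<open>Now 0 lies between \<open>m - B\<close> and \<open>m + A\<close>, so
      thresholded observations are covered as well.\<close>
    have "Phi (A - \<eta>) - Phi (- B) \<le> shift_cov (hard_thr \<eta>) A B m"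
      by (rule lower) (use 2 assms in \<open>auto simp: hard_thr_def\<close>)
    then show ?thesis by (simp add: shift_cov_nonneg)
  next
    case 3
    \<comment> \<open>Mirror image of the first case: the length is again
      \<open>A + B - \<eta>\<close>, but the endpoints add up to \<open>A - B + \<eta>\<close>,
      which is no further from 0 than \<open>A - B - \<eta>\<close> because
      \<open>A \<le> B\<close>.\<close>
    have "Phi A - Phi (\<eta> - B) \<le> shift_cov (hard_thr \<eta>) A B m"
      by (rule lower) (use 3 assms in \<open>auto simp: hard_thr_def\<close>)
    then show ?thesis by (rule Phi_diff_le_if[rotated 2]) (use assms in \<open>auto simp: shift_cov_nonneg\<close>)
  qed
next
  \<comment> \<open>Just to the left of \<open>- A\<close> the value 0 is no longer covered, which
    forces \<open>m + w < - \<eta>\<close>.\<close>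
  fix \<epsilon> :: real assume "0 < \<epsilon>"
  then show "shift_cov (hard_thr \<eta>) A B (- A - \<epsilon>) \<le> max 0 (Phi (A - \<eta> + \<epsilon>) - Phi (- B))"
    by (intro shift_cov_upper) (use assms in \<open>auto simp: hard_thr_def split: if_splits\<close>)
next
  show "((\<lambda>\<epsilon>. max 0 (Phi (A - \<eta> + \<epsilon>) - Phi (- B))) \<longlongrightarrow> max 0 (Phi (A - \<eta>) - Phi (- B))) (at_right 0)"
    using tendsto_max_Phi_diff[of "\<lambda>\<epsilon>. A - \<eta> + \<epsilon>" "\<lambda>_. - B"] by simp
qed

section \<open>Soft thresholding\<close>

definition soft_thr :: "real \<Rightarrow> real \<Rightarrow> real"
  where "soft_thr \<eta> t = (if t > \<eta> then t - \<eta> else if t < - \<eta> then t + \<eta> else 0)"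

lemma soft_thr_measurable: "soft_thr \<eta> \<in> borel_measurable borel"
  unfolding soft_thr_def by measurable

lemma soft_thr_odd: "0 < \<eta> \<Longrightarrow> soft_thr \<eta> (- t) = - soft_thr \<eta> t"
  by (auto simp: soft_thr_def)

lemma INF_shift_cov_soft:
  assumes "0 < \<eta>" "0 \<le> A" "A \<le> B"
  shows "(INF m. shift_cov (soft_thr \<eta>) A B m) = max 0 (Phi (A - \<eta>) - Phi (- B - \<eta>))"
proof (rule INF_eq_if_bounds)
  note lower = shift_cov_lower[OF soft_thr_measurable]
  fix m
  consider "m \<le> B" | "B < m" by linarith
  then show "max 0 (Phi (A - \<eta>) - Phi (- B - \<eta>)) \<le> shift_cov (soft_thr \<eta>) A B m"
  proof cases
    case 1
    \<comment> \<open>The regions \<open>m < - A\<close> and \<open>- A \<le> m \<le> B\<close> are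
      treated together: if \<open>T (m + w) = 0\<close> in the dead zone, then
      \<open>m + w \<ge> - \<eta>\<close> and \<open>w < A - \<eta>\<close> give
      \<open>m > - A\<close>, so 0 is covered.\<close>
    have "Phi (A - \<eta>) - Phi (- B - \<eta>) \<le> shift_cov (soft_thr \<eta>) A B m"
      by (rule lower) (use 1 assms in \<open>auto simp: soft_thr_def\<close>)
    then show ?thesis by (simp add: shift_cov_nonneg)
  next
    case 2
    have "Phi (A + \<eta>) - Phi (- B + \<eta>) \<le> shift_cov (soft_thr \<eta>) A B m"
      by (rule lower) (use 2 assms in \<open>auto simp: soft_thr_def\<close>)
    then show ?thesis by (rule Phi_diff_le_if[rotated 2]) (use assms in \<open>auto simp: shift_cov_nonneg\<close>)
  qed
next
  \<comment> \<open>The bound does not depend on \<open>\<epsilon>\<close>: to the left of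
    \<open>- A\<close> the infimum is attained.\<close>
  fix \<epsilon> :: real assume "0 < \<epsilon>"
  then show "shift_cov (soft_thr \<eta>) A B (- A - \<epsilon>) \<le> max 0 (Phi (A - \<eta>) - Phi (- B - \<eta>))"
    by (intro shift_cov_upper) (use assms in \<open>auto simp: soft_thr_def split: if_splits\<close>)
qed auto

section \<open>Adaptive soft thresholding\<close>

definition adsoft_thr :: "real \<Rightarrow> real \<Rightarrow> real"
  where "adsoft_thr \<eta> t = (if \<bar>t\<bar> > \<eta> then t - \<eta>\<^sup>2 / t else 0)"

lemma adsoft_thr_measurable: "adsoft_thr \<eta> \<in> borel_measurable borel"
  unfolding adsoft_thr_def by measurable

lemma adsoft_thr_odd: "adsoft_thr \<eta> (- t) = - adsoft_thr \<eta> t"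
  by (simp add: adsoft_thr_def)

text \<open>The shrinkage at output level \<open>u \<ge> 0\<close>: the solution \<open>t > 0\<close> of
  \<open>t - \<eta>\<^sup>2 / t = u\<close> is \<open>t = u + shrink \<eta> u\<close>.\<close>

definition shrink :: "real \<Rightarrow> real \<Rightarrow> real"
  where "shrink \<eta> u = sqrt (u\<^sup>2 / 4 + \<eta>\<^sup>2) - u / 2"

context
  fixes \<eta> :: real
  assumes eta: "0 < \<eta>"
begin

lemma sqrt_quad_bounds: "\<bar>u\<bar> / 2 < sqrt (u\<^sup>2 / 4 + \<eta>\<^sup>2)" "\<eta> \<le> sqrt (u\<^sup>2 / 4 + \<eta>\<^sup>2)"
proof -
  show "\<bar>u\<bar> / 2 < sqrt (u\<^sup>2 / 4 + \<eta>\<^sup>2)"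
    by (rule real_less_rsqrt) (use eta in \<open>simp add: power_divide\<close>)
  show "\<eta> \<le> sqrt (u\<^sup>2 / 4 + \<eta>\<^sup>2)"
    by (rule real_le_rsqrt) simp
qed

lemma shrink_pos: "0 < shrink \<eta> u"
  using sqrt_quad_bounds(1)[of u] by (simp add: shrink_def)

lemma shrink_0: "shrink \<eta> 0 = \<eta>"
  using eta by (simp add: shrink_def)

lemma shrink_root: "shrink \<eta> u * (u + shrink \<eta> u) = \<eta>\<^sup>2"
proof -
  have "(sqrt (u\<^sup>2 / 4 + \<eta>\<^sup>2))\<^sup>2 = u\<^sup>2 / 4 + \<eta>\<^sup>2" by simp
  then show ?thesis unfolding shrink_def by (simp add: power2_eq_square algebra_simps)
qed

text \<open>By \<open>shrink_root\<close> the product of \<open>shrink \<eta> u\<close> and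
  \<open>u + shrink \<eta> u\<close> is constant; were the shrinkage to grow with \<open>u\<close>,
  both factors would grow.\<close>

lemma shrink_antimono:
  assumes "0 \<le> u" "u \<le> v"
  shows "shrink \<eta> v \<le> shrink \<eta> u"
proof (rule ccontr)
  assume "\<not> ?thesis"
  then have "shrink \<eta> u < shrink \<eta> v" by simp
  then have "shrink \<eta> u * (u + shrink \<eta> u) < shrink \<eta> v * (v + shrink \<eta> v)"
    by (intro mult_strict_mono) (use assms shrink_pos[of u] shrink_pos[of v] in auto)
  then show False by (simp add: shrink_root)
qed

lemma shrink_le: "0 \<le> u \<Longrightarrow> shrink \<eta> u \<le> \<eta>"
  using shrink_antimono[of 0 u] by (simp add: shrink_0)

lemma eta_le_shrink: "0 \<le> u \<Longrightarrow> \<eta> + u / 2 \<le> u + shrink \<eta> u"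
  using sqrt_quad_bounds(2)[of u] by (simp add: shrink_def)

text \<open>An instance of the convexity of \<open>shrink \<eta>\<close>.\<close>

lemma shrink_increment:
  assumes "0 \<le> u" "0 \<le> v"
  shows "shrink \<eta> u + shrink \<eta> v \<le> \<eta> + shrink \<eta> (u + v)"
proof -
  \<comment> \<open>The linear parts of \<open>shrink\<close> cancel, leaving
    \<open>q u + q v \<le> \<eta> + q (u + v)\<close>. Squaring reduces this to a bound on
    \<open>q u * q v\<close>, which is squared once more; the slack is then a nonnegative multiple
    of \<open>u * v\<close>.\<close>
  define q where "q u = sqrt (u\<^sup>2 / 4 + \<eta>\<^sup>2)" for u
  have q2: "(q u)\<^sup>2 = u\<^sup>2 / 4 + \<eta>\<^sup>2" for u by (simp add: q_def)
  have q0: "0 \<le> q u" for u by (simp add: q_def)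
  have uv: "0 \<le> u * v" using assms by simp
  have "(q u * q v)\<^sup>2 \<le> (u * v / 4 + \<eta> * q (u + v))\<^sup>2"
  proof -
    have "(q u * q v)\<^sup>2 = (u\<^sup>2 / 4 + \<eta>\<^sup>2) * (v\<^sup>2 / 4 + \<eta>\<^sup>2)"
      by (simp add: power_mult_distrib q2)
    also have "\<dots> \<le> (u * v / 4)\<^sup>2 + \<eta>\<^sup>2 * ((u + v)\<^sup>2 / 4 + \<eta>\<^sup>2)"
      using mult_nonneg_nonneg[OF uv, of "\<eta>\<^sup>2"] by (simp add: power2_eq_square field_simps)
    also have "\<dots> = (u * v / 4)\<^sup>2 + (\<eta> * q (u + v))\<^sup>2"
      by (simp add: power_mult_distrib q2)
    also have "\<dots> \<le> (u * v / 4 + \<eta> * q (u + v))\<^sup>2"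
      using mult_nonneg_nonneg[OF uv mult_nonneg_nonneg[OF less_imp_le[OF eta] q0[of "u + v"]]]
      by (simp add: power2_sum)
    finally show ?thesis .
  qed
  then have "q u * q v \<le> u * v / 4 + \<eta> * q (u + v)"
    by (rule power2_le_imp_le) (use uv eta q0[of "u + v"] in auto)
  then have "(q u + q v)\<^sup>2 \<le> (\<eta> + q (u + v))\<^sup>2"
    unfolding power2_sum q2 by (simp add: power2_eq_square field_simps)
  then have "q u + q v \<le> \<eta> + q (u + v)"
    by (rule power2_le_imp_le) (use eta q0[of "u + v"] in auto)
  then show ?thesis by (simp add: shrink_def q_def field_simps)
qed

lemma isCont_shrink: "isCont (shrink \<eta>) u"
  unfolding shrink_def by (intro continuous_intros) auto

text \<open>The quadratic t^2 - x t - \<eta>^2 has the roots \<open>x + shrink \<eta> x\<close> and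
  \<open>- shrink \<eta> x\<close>.\<close>

lemma adsoft_factor:
  assumes "0 < t"
  shows "t - \<eta>\<^sup>2 / t - x = (t - (x + shrink \<eta> x)) * (t + shrink \<eta> x) / t"
  using assms by (simp add: shrink_root[of x, symmetric] field_simps)

text \<open>For \<open>t > \<eta>\<close> the sign is read off the factorisation. Otherwise both
  sides fail: the output is at most 0, while \<open>x + shrink \<eta> x\<close> exceeds
  \<open>\<eta>\<close>.\<close>

lemma adsoft_thr_ge_iff:
  assumes "0 < x"
  shows "x \<le> adsoft_thr \<eta> t \<longleftrightarrow> x + shrink \<eta> x \<le> t"
proof (cases "t > \<eta>")
  case True
  then have t: "0 < t" "0 < t + shrink \<eta> x" using eta shrink_pos[of x] by auto
  have "x \<le> adsoft_thr \<eta> t \<longleftrightarrow> 0 \<le> t - \<eta>\<^sup>2 / t - x"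
    using True eta by (auto simp: adsoft_thr_def)
  also have "\<dots> \<longleftrightarrow> x + shrink \<eta> x \<le> t"
    unfolding adsoft_factor[OF t(1)] using t by (simp add: zero_le_divide_iff zero_le_mult_iff)
  finally show ?thesis .
next
  case False
  have "adsoft_thr \<eta> t \<le> 0"
  proof (cases "t < - \<eta>")
    case True
    then have "\<eta> * \<eta> \<le> (- t) * (- t)" using eta by (intro mult_mono) auto
    then show ?thesis using True eta by (simp add: adsoft_thr_def power2_eq_square field_simps)
  qed (use False in \<open>auto simp: adsoft_thr_def\<close>)
  then show ?thesis using assms False eta_le_shrink[of x] by linarith
qed

lemma adsoft_thr_le_iff:
  assumes "0 \<le> x"
  shows "adsoft_thr \<eta> t \<le> x \<longleftrightarrow> t \<le> x + shrink \<eta> x"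
proof (cases "t > \<eta>")
  case True
  then have t: "0 < t" "0 < t + shrink \<eta> x" using eta shrink_pos[of x] by auto
  have "adsoft_thr \<eta> t \<le> x \<longleftrightarrow> t - \<eta>\<^sup>2 / t - x \<le> 0"
    using True eta by (auto simp: adsoft_thr_def)
  also have "\<dots> \<longleftrightarrow> t \<le> x + shrink \<eta> x"
    unfolding adsoft_factor[OF t(1)] using t by (simp add: divide_le_0_iff mult_le_0_iff)
  finally show ?thesis .
next
  case False
  \<comment> \<open>A positive output, taken itself as the level in
    \<open>adsoft_thr_ge_iff\<close>, would force \<open>t > \<eta>\<close>.\<close>
  have "adsoft_thr \<eta> t \<le> 0"
    using False adsoft_thr_ge_iff[of "adsoft_thr \<eta> t" t] eta_le_shrink[of "adsoft_thr \<eta> t"]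
    by fastforce
  then show ?thesis using assms False eta_le_shrink[of x] by linarith
qed

lemma adsoft_thr_neg_le_iff: "0 < x \<Longrightarrow> adsoft_thr \<eta> t \<le> - x \<longleftrightarrow> t \<le> - x - shrink \<eta> x"
  using adsoft_thr_ge_iff[of x "- t"] by (auto simp: adsoft_thr_odd)

lemma adsoft_thr_neg_ge_iff: "0 \<le> x \<Longrightarrow> - x \<le> adsoft_thr \<eta> t \<longleftrightarrow> - x - shrink \<eta> x \<le> t"
  using adsoft_thr_le_iff[of x "- t"] by (auto simp: adsoft_thr_odd)

lemma INF_shift_cov_adsoft:
  assumes "0 \<le> A" "A \<le> B"
  shows "(INF m. shift_cov (adsoft_thr \<eta>) A B m) =
    max 0 (Phi (A - \<eta>) - Phi (- B - shrink \<eta> (A + B)))"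
proof (rule INF_eq_if_bounds)
  note lower = shift_cov_lower[OF adsoft_thr_measurable]
  note nonneg = shift_cov_nonneg
  fix m
  consider "m < - A" | "- A \<le> m" "m \<le> B" | "B < m" by linarith
  then show "max 0 (Phi (A - \<eta>) - Phi (- B - shrink \<eta> (A + B))) \<le> shift_cov (adsoft_thr \<eta>) A B m"
  proof cases
    case 1
    define x where "x = - m - A"
    have x: "0 < x" "m - B = - (x + (A + B))" "m + A = - x" using 1 by (auto simp: x_def)
    have xx: "0 \<le> x + (A + B)" using x assms by simp
    have *: "Phi (A - shrink \<eta> x) - Phi (- B - shrink \<eta> (x + (A + B))) \<le> shift_cov (adsoft_thr \<eta>) A B m"
      by (rule lower, unfold x(2,3) adsoft_thr_neg_le_iff[OF x(1)] adsoft_thr_neg_ge_iff[OF xx])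
        (auto simp: x_def)
    \<comment> \<open>The covered interval is at least as long as the target by
      \<open>shrink_increment\<close>, and its centre, negative like that of the target, is no
      further from 0 because \<open>shrink\<close> is at most \<open>\<eta>\<close> and
      antimonotone.\<close>
    show ?thesis
      by (rule Phi_diff_le_if[OF _ _ * nonneg])
        (use assms x shrink_increment[of x "A + B"] shrink_le[of x] shrink_antimono[of "A + B" "x + (A + B)"]
           shrink_pos[of x] shrink_pos[of "x + (A + B)"] in auto)
  next
    case 2
    have ge: "- (B - m) \<le> adsoft_thr \<eta> (m + w) \<longleftrightarrow> - B - shrink \<eta> (B - m) \<le> w" for w
      using 2 by (subst adsoft_thr_neg_ge_iff) auto
    have le: "adsoft_thr \<eta> (m + w) \<le> m + A \<longleftrightarrow> w \<le> A + shrink \<eta> (m + A)" for w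
      using 2 by (subst adsoft_thr_le_iff) auto
    \<comment> \<open>The exact covered range of \<open>w\<close> runs from
      \<open>- B - shrink \<eta> (B - m)\<close> to \<open>A + shrink \<eta> (m + A)\<close>. It
      contains the target since \<open>B - m \<le> A + B\<close>.\<close>
    have "Phi (A - \<eta>) - Phi (- B - shrink \<eta> (A + B)) \<le> shift_cov (adsoft_thr \<eta>) A B m"
      by (rule lower)
        (use 2 eta ge le shrink_antimono[of "B - m" "A + B"] shrink_pos[of "m + A"] in auto)
    then show ?thesis by (simp add: nonneg)
  next
    case 3
    define x where "x = m - B"
    have x: "0 < x" "m - B = x" "m + A = x + (A + B)" using 3 by (auto simp: x_def)
    have xx: "0 \<le> x + (A + B)" using x assms by simp
    have *: "Phi (A + shrink \<eta> (x + (A + B))) - Phi (- B + shrink \<eta> x) \<le> shift_cov (adsoft_thr \<eta>) A B m"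
      by (rule lower, unfold x(2,3) adsoft_thr_ge_iff[OF x(1)] adsoft_thr_le_iff[OF xx])
        (auto simp: x_def)
    \<comment> \<open>Same length as at the reflected position, with the shrinkage now pushing the
      centre upwards; \<open>A \<le> B\<close> keeps it no further from 0 than the target
      centre.\<close>
    show ?thesis
      by (rule Phi_diff_le_if[OF _ _ * nonneg])
        (use assms x shrink_increment[of x "A + B"] shrink_le[of x] shrink_antimono[of "A + B" "x + (A + B)"]
           shrink_pos[of x] shrink_pos[of "x + (A + B)"] in auto)
  qed
next
  \<comment> \<open>At distance \<open>\<epsilon>\<close> to the left of \<open>- A\<close> the
    endpoints tend to those of the target, as \<open>shrink \<eta>\<close> is continuous with value
    \<open>\<eta>\<close> at 0.\<close>
  fix \<epsilon> :: real assume \<epsilon>: "0 < \<epsilon>"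
  have x: "- A - \<epsilon> - B = - (\<epsilon> + (A + B))" "- A - \<epsilon> + A = - \<epsilon>" by auto
  have xx: "0 \<le> \<epsilon> + (A + B)" using \<epsilon> assms by simp
  show "shift_cov (adsoft_thr \<eta>) A B (- A - \<epsilon>) \<le>
      max 0 (Phi (A - shrink \<eta> \<epsilon>) - Phi (- B - shrink \<eta> (\<epsilon> + (A + B))))"
    by (rule shift_cov_upper, unfold x adsoft_thr_neg_le_iff[OF \<epsilon>] adsoft_thr_neg_ge_iff[OF xx]) auto
next
  show "((\<lambda>\<epsilon>. max 0 (Phi (A - shrink \<eta> \<epsilon>) - Phi (- B - shrink \<eta> (\<epsilon> + (A + B)))))
      \<longlongrightarrow> max 0 (Phi (A - \<eta>) - Phi (- B - shrink \<eta> (A + B)))) (at_right 0)"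
    using tendsto_max_Phi_diff[of "\<lambda>\<epsilon>. A - shrink \<eta> \<epsilon>" "\<lambda>\<epsilon>. - B - shrink \<eta> (\<epsilon> + (A + B))"]
    by (simp add: shrink_0 continuous_intros isCont_shrink isCont_o2[OF _ isCont_shrink])
qed

end

section \<open>Shortest intervals\<close>

lemma INF_shift_cov_min_max:
  assumes "T \<in> borel_measurable borel" "\<And>t. T (- t) = - T t"
  shows "(INF m. shift_cov T A B m) = (INF m. shift_cov T (min A B) (max A B) m)"
  using INF_shift_cov_swap[OF assms, of A B] by (cases "A \<le> B") (auto simp: min_def max_def)

lemma central_tendsto_1:
  assumes "filterlim w at_top F"
  shows "((\<lambda>x. central c (w x)) \<longlongrightarrow> 1) F"
proof -
  have "filterlim (\<lambda>x. c + w x) at_top F"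
    by (rule filterlim_tendsto_add_at_top[OF tendsto_const assms])
  moreover have "filterlim (\<lambda>x. - (- c + w x)) at_bot F"
    by (rule filterlim_compose[OF filterlim_uminus_at_bot_at_top
          filterlim_tendsto_add_at_top[OF tendsto_const assms]])
  ultimately have "((\<lambda>x. Phi (c + w x) - Phi (- (- c + w x))) \<longlongrightarrow> 1 - 0) F"
    by (intro tendsto_diff filterlim_compose[OF Phi_at_top] filterlim_compose[OF Phi_at_bot])
  then show ?thesis by (simp add: central_def)
qed

text \<open>For an interval of given length \<open>a + b\<close> the infimal coverage is the normal probability of an
  interval whose radius depends only on \<open>a + b\<close> and whose centre moves away from \<open>0\<close> with
  \<open>\<bar>a - b\<bar>\<close>; so the symmetric choice is optimal.\<close>

lemma shortest_symmetric:
  fixes C :: "real \<Rightarrow> real \<Rightarrow> real" and d w :: "real \<Rightarrow> real"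
  assumes C: "\<And>a b. 0 \<le> a \<Longrightarrow> 0 \<le> b \<Longrightarrow>
      C a b = max 0 (central (\<kappa> * \<bar>a - b\<bar> / 2 + d (\<kappa> * (a + b))) (w (\<kappa> * (a + b))))"
    and pos: "0 < \<kappa>" "0 < \<sigma>" "0 < \<alpha>" "\<alpha> < 1"
    and d_nonneg: "\<And>L. 0 \<le> L \<Longrightarrow> 0 \<le> d L"
    and d_antimono: "\<And>L L'. 0 \<le> L \<Longrightarrow> L \<le> L' \<Longrightarrow> d L' \<le> d L"
    and d_cont: "\<And>L. isCont d L"
    and w_mono: "\<And>L L'. 0 \<le> L \<Longrightarrow> L < L' \<Longrightarrow> w L < w L'"
    and w_cont: "\<And>L. isCont w L"
    and w0: "w 0 \<le> 0" and w_top: "filterlim w at_top at_top"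
    and g: "\<And>a. 0 \<le> a \<Longrightarrow> g a = central (d (2 * \<kappa> * a)) (w (2 * \<kappa> * a))"
  obtains a0 where "0 < a0" "0 < w (2 * \<kappa> * a0)" "g a0 = 1 - \<alpha>"
    "\<And>a. 0 \<le> a \<Longrightarrow> g a = 1 - \<alpha> \<Longrightarrow> a = a0"
    "shortest C \<alpha> \<sigma> a0 a0" "C a0 a0 = 1 - \<alpha>"
    "\<exists>!p. shortest C \<alpha> \<sigma> (fst p) (snd p)"
proof -
  \<comment> \<open>\<open>\<psi> L\<close> is the untruncated coverage of the symmetric interval of
    rescaled length \<open>L\<close>.\<close>
  define \<psi> where "\<psi> L = central (d L) (w L)" for L
  have w_pos: "0 < w L" if "0 < central c (w L)" for c L
    using central_nonpos[of "w L" c] that by linarith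
  \<comment> \<open>Positivity of \<open>\<psi> L\<close> makes the radius positive, as the
    recentring comparison requires; afterwards the radius grows strictly.\<close>
  have \<psi>_mono: "\<psi> L < \<psi> L'" if "0 \<le> L" "L < L'" "0 < \<psi> L" for L L'
  proof -
    have "central (d L) (w L) \<le> central (d L') (w L)"
      using that d_nonneg[of L] d_nonneg[of L'] d_antimono[of L L'] w_pos[of "d L" L]
      by (intro central_mono) (auto simp: \<psi>_def)
    also have "\<dots> < central (d L') (w L')"
      by (rule central_strict_mono_radius[OF w_mono[OF that(1,2)]])
    finally show ?thesis by (simp add: \<psi>_def)
  qed
  \<comment> \<open>The centre is frozen at its largest value \<open>d 0\<close>, so coverage at
    large \<open>L\<close> is bounded below by a quantity tending to 1. The intermediate value
    theorem between 0 and \<open>L1\<close> then yields the length \<open>L0\<close>.\<close>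
  have "eventually (\<lambda>L. 1 - \<alpha> < central (d 0) (w L)) at_top"
    using central_tendsto_1[OF w_top, of "d 0"] pos by (auto elim!: order_tendstoD)
  moreover have "eventually (\<lambda>L. 0 \<le> w L) at_top"
    using w_top by (simp add: filterlim_at_top)
  ultimately have "eventually (\<lambda>L. 1 - \<alpha> < central (d 0) (w L) \<and> 0 \<le> w L \<and> 0 \<le> L) at_top"
    by (intro eventually_conj eventually_ge_at_top)
  then obtain L1 where L1: "1 - \<alpha> < central (d 0) (w L1)" "0 \<le> w L1" "0 \<le> L1"
    by (auto dest: eventually_happens)
  have "central (d 0) (w L1) \<le> \<psi> L1"
    unfolding \<psi>_def using L1 d_antimono[of 0 L1] d_nonneg[of L1] by (intro central_mono) auto
  moreover have \<psi>0: "\<psi> 0 \<le> 0" unfolding \<psi>_def by (rule central_nonpos[OF w0])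
  moreover have "continuous_on {0..L1} \<psi>"
    unfolding \<psi>_def central_def
    by (rule continuous_on_diff; rule continuous_on_Phi; intro continuous_on_add continuous_on_diff)
      (auto intro!: continuous_at_imp_continuous_on d_cont w_cont)
  ultimately obtain L0 where L0: "0 \<le> L0" "\<psi> L0 = 1 - \<alpha>"
    using IVT'[of \<psi> 0 "1 - \<alpha>" L1] L1 pos by auto
  then have "0 < L0" using \<psi>0 pos by (cases "L0 = 0") auto
  define a0 where "a0 = L0 / (2 * \<kappa>)"
  have a0: "0 < a0" "2 * \<kappa> * a0 = L0" "\<kappa> * (a0 + a0) = L0"
    using \<open>0 < L0\<close> pos by (auto simp: a0_def)
  have wL0: "0 < w L0" using w_pos[of "d L0" L0] L0 pos by (simp add: \<psi>_def)
  have "C a0 a0 = max 0 (\<psi> L0)" using C[of a0 a0, unfolded a0(3)] a0(1) by (simp add: \<psi>_def)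
  then have Ca0: "C a0 a0 = 1 - \<alpha>" using L0 pos by simp
  \<comment> \<open>Symmetrising an admissible interval keeps its length and does not lower its
    coverage, so its rescaled length is at least \<open>L0\<close>. At equality any asymmetry would
    strictly push the coverage below \<open>1 - \<alpha>\<close>.\<close>
  have longer: "L0 \<le> \<kappa> * (a + b) \<and> (L0 = \<kappa> * (a + b) \<longrightarrow> a = b)"
    if ab: "0 \<le> a" "0 \<le> b" "1 - \<alpha> \<le> C a b" for a b
  proof -
    define L where "L = \<kappa> * (a + b)"
    have L: "0 \<le> L" using ab pos by (simp add: L_def)
    have cov: "1 - \<alpha> \<le> central (\<kappa> * \<bar>a - b\<bar> / 2 + d L) (w L)"
      using C[OF ab(1,2)] ab(3) pos by (auto simp: L_def max_def split: if_splits)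
    then have wL: "0 < w L"
      by (intro w_pos[of "\<kappa> * \<bar>a - b\<bar> / 2 + d L"]) (use pos in linarith)
    have "central (\<kappa> * \<bar>a - b\<bar> / 2 + d L) (w L) \<le> \<psi> L"
      unfolding \<psi>_def using wL d_nonneg[OF L] pos by (intro central_mono) auto
    then have \<psi>L: "1 - \<alpha> \<le> \<psi> L" using cov by simp
    then have "L0 \<le> L" using \<psi>_mono[of L L0] L L0 pos by fastforce
    moreover have "a = b" if "L0 = L"
    proof (rule ccontr)
      assume "a \<noteq> b"
      then have "0 < \<kappa> * \<bar>a - b\<bar> / 2" using pos by simp
      then have "central (\<kappa> * \<bar>a - b\<bar> / 2 + d L) (w L) < \<psi> L"
        unfolding \<psi>_def using d_nonneg[OF L] wL by (intro central_strict_antimono_center) auto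
      then show False using cov L0 that by simp
    qed
    ultimately show ?thesis by (simp add: L_def)
  qed
  have sh: "shortest C \<alpha> \<sigma> a0 a0"
    unfolding shortest_def
  proof (intro conjI allI impI)
    fix a b assume ab: "0 \<le> a \<and> 0 \<le> b \<and> 1 - \<alpha> \<le> C a b"
    then have "\<kappa> * (a0 + a0) \<le> \<kappa> * (a + b)" using longer[of a b] a0 by simp
    then show "\<sigma> * (a0 + a0) \<le> \<sigma> * (a + b)" using pos by simp
  qed (use a0 Ca0 in auto)
  show thesis
  proof (rule that[of a0])
    show "0 < a0" "0 < w (2 * \<kappa> * a0)" "shortest C \<alpha> \<sigma> a0 a0" "C a0 a0 = 1 - \<alpha>"
      using a0 wL0 sh Ca0 by simp_all
    show "g a0 = 1 - \<alpha>" using g[of a0] a0 L0 by (simp add: \<psi>_def)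
    fix a assume a: "0 \<le> a" "g a = 1 - \<alpha>"
    then have "\<psi> (2 * \<kappa> * a) = 1 - \<alpha>" using g[of a] by (simp add: \<psi>_def)
    then have "2 * \<kappa> * a = L0"
      using \<psi>_mono[of L0 "2 * \<kappa> * a"] \<psi>_mono[of "2 * \<kappa> * a" L0] a L0 pos
      by (cases "2 * \<kappa> * a" L0 rule: linorder_cases) auto
    then show "a = a0" using pos by (simp add: a0_def field_simps)
  next
    show "\<exists>!p. shortest C \<alpha> \<sigma> (fst p) (snd p)"
    proof (rule ex1I[of _ "(a0, a0)"])
      show "shortest C \<alpha> \<sigma> (fst (a0, a0)) (snd (a0, a0))" using sh by simp
      fix p assume p: "shortest C \<alpha> \<sigma> (fst p) (snd p)"
      then have ab: "0 \<le> fst p" "0 \<le> snd p" "1 - \<alpha> \<le> C (fst p) (snd p)"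
        by (auto simp: shortest_def)
      have "\<sigma> * (fst p + snd p) \<le> \<sigma> * (a0 + a0)"
      proof -
        have "0 \<le> a0 \<and> 0 \<le> a0 \<and> 1 - \<alpha> \<le> C a0 a0" using a0(1) Ca0 by simp
        then show ?thesis using p unfolding shortest_def by blast
      qed
      then have "\<kappa> * (fst p + snd p) \<le> \<kappa> * (a0 + a0)" using pos by simp
      then have "\<kappa> * (fst p + snd p) \<le> L0" unfolding a0(3) .
      then have "L0 = \<kappa> * (fst p + snd p)" "fst p = snd p" using longer[OF ab] by auto
      then show "p = (a0, a0)" using pos by (auto simp: a0_def prod_eq_iff)
    qed
  qed
qed

text \<open>The unit is the standard deviation \<open>\<sigma> * xi X i / s\<close> of the least
  squares component. Coverage depends on \<open>\<theta>\<close> only through its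
  \<open>i\<close>-th entry, which ranges over all reals, so the infimum becomes one over
  \<open>m\<close>.\<close>

lemma inf_cov_eq_INF_shift_cov:
  fixes X :: "real^'k^'n"
  assumes rank: "rank X = CARD('k)" and \<sigma>: "0 < \<sigma>" and T: "T \<in> borel_measurable borel"
    and s: "s = sqrt (real CARD('n))"
    and est: "\<And>y. est y = \<sigma> * xi X i / s * T (ls_est X y $ i / (\<sigma> * xi X i / s))"
  shows "inf_cov X \<sigma> i est a b = (INF m. shift_cov T (s / xi X i * a) (s / xi X i * b) m)"
proof -
  define \<tau> where "\<tau> = \<sigma> * xi X i / s"
  have \<xi>: "0 < xi X i" by (rule xi_pos[OF rank])
  have "0 < s" by (simp add: s)
  then have \<tau>: "0 < \<tau>" using \<xi> \<sigma> by (simp add: \<tau>_def)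
  have scale: "\<sigma> * c = \<tau> * (s / xi X i * c)" for c
    using \<xi> \<open>0 < s\<close> by (simp add: \<tau>_def)
  have [measurable]: "T \<in> borel_measurable borel" by fact
  have "measure (reg_model X \<theta> \<sigma>) {y. est y - \<sigma> * a \<le> \<theta> $ i \<and> \<theta> $ i \<le> est y + \<sigma> * b} =
      shift_cov T (s / xi X i * a) (s / xi X i * b) (\<theta> $ i / \<tau>)" for \<theta>
  proof -
    have "measure (reg_model X \<theta> \<sigma>) {y. est y - \<sigma> * a \<le> \<theta> $ i \<and> \<theta> $ i \<le> est y + \<sigma> * b} =
        measure std_normal_distribution
          {w. \<tau> * T ((\<theta> $ i + \<tau> * w) / \<tau>) - \<sigma> * a \<le> \<theta> $ i \<and>
              \<theta> $ i \<le> \<tau> * T ((\<theta> $ i + \<tau> * w) / \<tau>) + \<sigma> * b}"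
      unfolding est \<tau>_def s
      by (rule measure_ls_est[OF rank \<sigma>]) measurable
    also have "\<dots> = shift_cov T (s / xi X i * a) (s / xi X i * b) (\<theta> $ i / \<tau>)"
      unfolding shift_cov_def
    proof (rule arg_cong[where f="measure _"], rule Collect_cong)
      fix w
      define m where "m = \<theta> $ i / \<tau>"
      have m: "\<theta> $ i = \<tau> * m" "(\<tau> * m + \<tau> * w) / \<tau> = m + w"
        using \<tau> by (auto simp: m_def field_simps)
      have "\<tau> * T (m + w) - \<tau> * A \<le> \<tau> * m \<longleftrightarrow> T (m + w) \<le> m + A"
        "\<tau> * m \<le> \<tau> * T (m + w) + \<tau> * A \<longleftrightarrow> m - A \<le> T (m + w)" for A
        using \<tau> mult_le_cancel_left_pos[OF \<tau>, of "T (m + w)" "m + A"]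
          mult_le_cancel_left_pos[OF \<tau>, of "m - A" "T (m + w)"]
        by (auto simp: algebra_simps)
      then show "(\<tau> * T ((\<theta> $ i + \<tau> * w) / \<tau>) - \<sigma> * a \<le> \<theta> $ i \<and>
          \<theta> $ i \<le> \<tau> * T ((\<theta> $ i + \<tau> * w) / \<tau>) + \<sigma> * b) \<longleftrightarrow>
          (\<theta> $ i / \<tau> - s / xi X i * b \<le> T (\<theta> $ i / \<tau> + w) \<and>
           T (\<theta> $ i / \<tau> + w) \<le> \<theta> $ i / \<tau> + s / xi X i * a)"
        unfolding scale[of a] scale[of b] m_def[symmetric] unfolding m by blast
    qed
    finally show ?thesis .
  qed
  then have "inf_cov X \<sigma> i est a b =
      (INF \<theta>. shift_cov T (s / xi X i * a) (s / xi X i * b) (\<theta> $ i / \<tau>))"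
    by (simp add: inf_cov_def)
  moreover have "range (\<lambda>\<theta>::real^'k. \<theta> $ i / \<tau>) = UNIV"
  proof (intro set_eqI iffI UNIV_I)
    fix m :: real
    have "m = (axis i (\<tau> * m) :: real^'k) $ i / \<tau>" using \<tau> by simp
    then show "m \<in> range (\<lambda>\<theta>::real^'k. \<theta> $ i / \<tau>)" by blast
  qed
  ultimately show ?thesis
    using image_image[of "shift_cov T (s / xi X i * a) (s / xi X i * b)" "\<lambda>\<theta>::real^'k. \<theta> $ i / \<tau>" UNIV]
    by simp
qed

text \<open>Here \<open>p\<close> and \<open>q\<close> are the smaller and larger rescaled margins,
  \<open>D\<close> is their gap and \<open>d\<close> the displacement due to thresholding; the
  centre is \<open>- (D / 2 + d)\<close>.\<close>

lemma abs_centre: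
  fixes c d p q D :: real
  assumes "2 * c = p - q - 2 * d" "q = p + D" "0 \<le> D" "0 \<le> d"
  shows "\<bar>c\<bar> = D / 2 + d"
  using assms by linarith

section \<open>The estimators as rescaled thresholding functions\<close>

lemma hard_thr_scale: "0 < \<tau> \<Longrightarrow> \<tau> * hard_thr e (t / \<tau>) = (if \<bar>t\<bar> > \<tau> * e then t else 0)"
  by (auto simp: hard_thr_def field_simps)

lemma soft_thr_scale:
  assumes "0 < \<tau>" "0 < e"
  shows "\<tau> * soft_thr e (t / \<tau>) = sgn t * max (\<bar>t\<bar> - \<tau> * e) 0"
proof -
  have "e < t / \<tau> \<longleftrightarrow> \<tau> * e < t" "t / \<tau> < - e \<longleftrightarrow> \<tau> * e < - t"
    using assms by (auto simp: field_simps)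
  moreover have "0 < \<tau> * e" using assms by simp
  ultimately show ?thesis using assms
    by (auto simp: soft_thr_def sgn_real_def max_def algebra_simps)
qed

lemma adsoft_thr_scale:
  assumes "0 < \<tau>" "0 < e"
  shows "\<tau> * adsoft_thr e (t / \<tau>) = t * max (1 - (\<tau> * e)\<^sup>2 / t\<^sup>2) 0"
proof (cases "\<tau> * e < \<bar>t\<bar>")
  case True
  then have t: "t \<noteq> 0" and "(\<tau> * e)\<^sup>2 \<le> t\<^sup>2"
    using assms abs_le_square_iff[of "\<tau> * e" t] by auto
  then have "0 \<le> 1 - (\<tau> * e)\<^sup>2 / t\<^sup>2" by simp
  moreover have "e < \<bar>t / \<tau>\<bar>" using True assms by (simp add: field_simps)
  ultimately show ?thesis using assms t
    by (simp add: adsoft_thr_def power2_eq_square field_simps)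
next
  case False
  then have "t\<^sup>2 \<le> (\<tau> * e)\<^sup>2" using assms abs_le_square_iff[of t "\<tau> * e"] by auto
  \<comment> \<open>At \<open>t = 0\<close> the quotient is 0 by convention and the positive part is
    1, but the factor \<open>t\<close> still makes the product 0.\<close>
  then have "t = 0 \<or> 1 - (\<tau> * e)\<^sup>2 / t\<^sup>2 \<le> 0" by (cases "t = 0") (auto simp: le_divide_eq)
  moreover have "\<not> e < \<bar>t / \<tau>\<bar>" using False assms by (simp add: field_simps)
  ultimately show ?thesis by (auto simp: adsoft_thr_def max_def)
qed

section \<open>Coverage formulas and shortest intervals in the original scale\<close>

context
  fixes s \<xi> \<eta> \<sigma> \<alpha> :: real and C :: "real \<Rightarrow> real \<Rightarrow> real"
  assumes pos: "0 < s" "0 < \<xi>" "0 < \<eta>" "0 < \<sigma>" "0 < \<alpha>" "\<alpha> < 1"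
begin

lemma scale_facts:
  "s * (c / \<xi> - \<eta>) = s / \<xi> * c - s * \<eta>" "0 < s / \<xi>" "0 < s * \<eta>"
  "s / \<xi> * min a b = min (s / \<xi> * a) (s / \<xi> * b)"
  "s / \<xi> * max a b = max (s / \<xi> * a) (s / \<xi> * b)"
  "0 \<le> s / \<xi> * \<bar>a - b\<bar>"
  using pos by (auto simp: field_simps min_mult_distrib_left max_mult_distrib_left)

lemma scale_max: "s / \<xi> * max a b = s / \<xi> * min a b + s / \<xi> * \<bar>a - b\<bar>"
  unfolding distrib_left[symmetric] by (simp add: min_def max_def)

lemma hard_intervals:
  assumes C: "\<And>a b. C a b = (INF m. shift_cov (hard_thr (s * \<eta>)) (s / \<xi> * a) (s / \<xi> * b) m)"
  shows "(\<forall>a b. 0 \<le> a \<longrightarrow> 0 \<le> b \<longrightarrow>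
       C a b =
         (if \<xi> * \<eta> \<le> a + b then
            (if a \<le> b then Phi (s * (a / \<xi> - \<eta>)) - Phi (- s * b / \<xi>)
             else Phi (s * (b / \<xi> - \<eta>)) - Phi (- s * a / \<xi>))
          else 0))
    \<and> (\<exists>!p. shortest C \<alpha> \<sigma> (fst p) (snd p))
    \<and> (\<exists>aH. 0 \<le> aH \<and> Phi (s * (aH / \<xi> - \<eta>)) - Phi (- s * aH / \<xi>) = 1 - \<alpha>
         \<and> (\<forall>a. 0 \<le> a \<and> Phi (s * (a / \<xi> - \<eta>)) - Phi (- s * a / \<xi>) = 1 - \<alpha> \<longrightarrow> a = aH)
         \<and> shortest C \<alpha> \<sigma> aH aH \<and> C aH aH = 1 - \<alpha> \<and> aH > \<xi> * \<eta> / 2)"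
proof -
  let ?\<kappa> = "s / \<xi>" and ?e = "s * \<eta>"
  have cov: "C a b = max 0 (Phi (?\<kappa> * min a b - ?e) - Phi (- (?\<kappa> * max a b)))"
    if "0 \<le> a" "0 \<le> b" for a b
    unfolding C scale_facts
    using that pos scale_facts(2,3)
    by (subst INF_shift_cov_min_max[OF hard_thr_measurable hard_thr_odd])
      (subst INF_shift_cov_hard, auto simp: le_max_iff_disj)
  have central: "C a b = max 0 (central (?\<kappa> * \<bar>a - b\<bar> / 2 + ?e / 2) ((?\<kappa> * (a + b) - ?e) / 2))"
    if "0 \<le> a" "0 \<le> b" for a b
  proof -
    have "\<bar>(- (?\<kappa> * max a b) + (?\<kappa> * min a b - ?e)) / 2\<bar> = ?\<kappa> * \<bar>a - b\<bar> / 2 + ?e / 2"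
      by (rule abs_centre[OF _ scale_max scale_facts(6)])
        (use scale_facts(3) in \<open>auto simp: field_simps\<close>)
    moreover have "?\<kappa> * min a b - ?e - - (?\<kappa> * max a b) = ?\<kappa> * (a + b) - ?e"
      by (simp add: algebra_simps add_divide_distrib min_def max_def)
    ultimately show ?thesis
      unfolding cov[OF that] Phi_diff_eq_central by (metis central_abs)
  qed
  have formula: "C a b =
         (if \<xi> * \<eta> \<le> a + b then
            (if a \<le> b then Phi (s * (a / \<xi> - \<eta>)) - Phi (- s * b / \<xi>)
             else Phi (s * (b / \<xi> - \<eta>)) - Phi (- s * a / \<xi>))
          else 0)" if "0 \<le> a" "0 \<le> b" for a b
  proof -
    \<comment> \<open>The case condition says exactly that the normal interval is nonempty, that is,
      that truncation at 0 is inactive.\<close>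
    have "\<xi> * \<eta> \<le> a + b \<longleftrightarrow> ?\<kappa> * (\<xi> * \<eta>) \<le> ?\<kappa> * (a + b)"
      using scale_facts(2) by (rule mult_le_cancel_left_pos[symmetric])
    also have "\<dots> \<longleftrightarrow> - (?\<kappa> * max a b) \<le> ?\<kappa> * min a b - ?e"
      using pos by (auto simp: max_def min_def distrib_left)
    finally have "\<xi> * \<eta> \<le> a + b \<longleftrightarrow> - (?\<kappa> * max a b) \<le> ?\<kappa> * min a b - ?e" .
    then show ?thesis
      unfolding cov[OF that] scale_facts(1)
      using Phi_mono[of "- (?\<kappa> * max a b)" "?\<kappa> * min a b - ?e"]
        Phi_mono[of "?\<kappa> * min a b - ?e" "- (?\<kappa> * max a b)"]
      by (auto simp: min_def max_def)
  qed
  have g: "Phi (s * (a / \<xi> - \<eta>)) - Phi (- s * a / \<xi>) = central (?e / 2) ((2 * ?\<kappa> * a - ?e) / 2)" for a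
  proof -
    have "\<bar>(- s * a / \<xi> + s * (a / \<xi> - \<eta>)) / 2\<bar> = \<bar>?e / 2\<bar>"
      "s * (a / \<xi> - \<eta>) - - s * a / \<xi> = 2 * ?\<kappa> * a - ?e"
      by (simp_all add: algebra_simps)
    then show ?thesis unfolding Phi_diff_eq_central by (metis central_abs)
  qed
  obtain a0 where a0: "0 < a0" "0 < (2 * ?\<kappa> * a0 - ?e) / 2"
    "Phi (s * (a0 / \<xi> - \<eta>)) - Phi (- s * a0 / \<xi>) = 1 - \<alpha>"
    "\<And>a. 0 \<le> a \<Longrightarrow> Phi (s * (a / \<xi> - \<eta>)) - Phi (- s * a / \<xi>) = 1 - \<alpha> \<Longrightarrow> a = a0"
    "shortest C \<alpha> \<sigma> a0 a0" "C a0 a0 = 1 - \<alpha>" "\<exists>!p. shortest C \<alpha> \<sigma> (fst p) (snd p)"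
  proof (rule shortest_symmetric[where C = C and \<kappa> = ?\<kappa> and \<sigma> = \<sigma> and \<alpha> = \<alpha> and
        d = "\<lambda>_. ?e / 2" and w = "\<lambda>L. (L - ?e) / 2"
        and g = "\<lambda>a. Phi (s * (a / \<xi> - \<eta>)) - Phi (- s * a / \<xi>)"])
    show "filterlim (\<lambda>L. (L - ?e) / 2) at_top at_top" by real_asymp
  qed (use pos scale_facts(2,3) central g in \<open>auto intro!: continuous_intros\<close>)
  \<comment> \<open>Positive coverage forces a positive radius at \<open>a0\<close>, which is this
    bound.\<close>
  have "\<xi> * \<eta> / 2 < a0" using a0(2) pos by (simp add: field_simps)
  then show ?thesis using formula a0 by (intro conjI exI[of _ a0]) auto
qed

lemma soft_intervals:
  assumes C: "\<And>a b. C a b = (INF m. shift_cov (soft_thr (s * \<eta>)) (s / \<xi> * a) (s / \<xi> * b) m)"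
  shows "(\<forall>a b. 0 \<le> a \<longrightarrow> 0 \<le> b \<longrightarrow>
       C a b =
         (if a \<le> b then Phi (s * (a / \<xi> - \<eta>)) - Phi (s * (- b / \<xi> - \<eta>))
          else Phi (s * (b / \<xi> - \<eta>)) - Phi (s * (- a / \<xi> - \<eta>))))
    \<and> (\<exists>!p. shortest C \<alpha> \<sigma> (fst p) (snd p))
    \<and> (\<exists>aS. 0 \<le> aS \<and> Phi (s * (aS / \<xi> - \<eta>)) - Phi (s * (- aS / \<xi> - \<eta>)) = 1 - \<alpha>
         \<and> (\<forall>a. 0 \<le> a \<and> Phi (s * (a / \<xi> - \<eta>)) - Phi (s * (- a / \<xi> - \<eta>)) = 1 - \<alpha> \<longrightarrow> a = aS)
         \<and> shortest C \<alpha> \<sigma> aS aS \<and> C aS aS = 1 - \<alpha> \<and> aS > 0)"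
proof -
  let ?\<kappa> = "s / \<xi>" and ?e = "s * \<eta>"
  have cov: "C a b = max 0 (Phi (?\<kappa> * min a b - ?e) - Phi (- (?\<kappa> * max a b) - ?e))"
    if "0 \<le> a" "0 \<le> b" for a b
    unfolding C scale_facts
    using that pos scale_facts(2,3)
    by (subst INF_shift_cov_min_max[OF soft_thr_measurable soft_thr_odd[OF scale_facts(3)]])
      (subst INF_shift_cov_soft, auto simp: le_max_iff_disj)
  have central: "C a b = max 0 (central (?\<kappa> * \<bar>a - b\<bar> / 2 + ?e) ((?\<kappa> * (a + b)) / 2))"
    if "0 \<le> a" "0 \<le> b" for a b
  proof -
    have "\<bar>(- (?\<kappa> * max a b) - ?e + (?\<kappa> * min a b - ?e)) / 2\<bar> = ?\<kappa> * \<bar>a - b\<bar> / 2 + ?e"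
      by (rule abs_centre[OF _ scale_max scale_facts(6)])
        (use scale_facts(3) in \<open>auto simp: field_simps\<close>)
    moreover have "?\<kappa> * min a b - ?e - (- (?\<kappa> * max a b) - ?e) = ?\<kappa> * (a + b)"
      by (simp add: algebra_simps add_divide_distrib min_def max_def)
    ultimately show ?thesis
      unfolding cov[OF that] Phi_diff_eq_central by (metis central_abs)
  qed
  have formula: "C a b =
         (if a \<le> b then Phi (s * (a / \<xi> - \<eta>)) - Phi (s * (- b / \<xi> - \<eta>))
          else Phi (s * (b / \<xi> - \<eta>)) - Phi (s * (- a / \<xi> - \<eta>)))" if "0 \<le> a" "0 \<le> b" for a b
  proof -
    \<comment> \<open>Both endpoints carry the same shift, so the interval is never empty and the
      truncation disappears.\<close>
    have "0 \<le> ?\<kappa> * max a b" "0 \<le> ?\<kappa> * min a b" using that pos by (auto simp: le_max_iff_disj)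
    then have "Phi (- (?\<kappa> * max a b) - ?e) \<le> Phi (?\<kappa> * min a b - ?e)"
      by (intro Phi_mono) simp
    then show ?thesis
      unfolding cov[OF that] scale_facts(1) by (auto simp: min_def max_def)
  qed
  have g: "Phi (s * (a / \<xi> - \<eta>)) - Phi (s * (- a / \<xi> - \<eta>)) = central ?e ((2 * ?\<kappa> * a) / 2)" for a
  proof -
    have "\<bar>(s * (- a / \<xi> - \<eta>) + s * (a / \<xi> - \<eta>)) / 2\<bar> = \<bar>?e\<bar>"
      "s * (a / \<xi> - \<eta>) - s * (- a / \<xi> - \<eta>) = 2 * ?\<kappa> * a"
      by (simp_all add: algebra_simps)
    then show ?thesis unfolding Phi_diff_eq_central by (metis central_abs)
  qed
  obtain a0 where a0: "0 < a0" "0 < (2 * ?\<kappa> * a0) / 2"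
    "Phi (s * (a0 / \<xi> - \<eta>)) - Phi (s * (- a0 / \<xi> - \<eta>)) = 1 - \<alpha>"
    "\<And>a. 0 \<le> a \<Longrightarrow> Phi (s * (a / \<xi> - \<eta>)) - Phi (s * (- a / \<xi> - \<eta>)) = 1 - \<alpha> \<Longrightarrow> a = a0"
    "shortest C \<alpha> \<sigma> a0 a0" "C a0 a0 = 1 - \<alpha>" "\<exists>!p. shortest C \<alpha> \<sigma> (fst p) (snd p)"
  proof (rule shortest_symmetric[where C = C and \<kappa> = ?\<kappa> and \<sigma> = \<sigma> and \<alpha> = \<alpha> and
        d = "\<lambda>_. ?e" and w = "\<lambda>L. L / 2"
        and g = "\<lambda>a. Phi (s * (a / \<xi> - \<eta>)) - Phi (s * (- a / \<xi> - \<eta>))"])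
    show "filterlim (\<lambda>L::real. L / 2) at_top at_top" by real_asymp
  qed (use pos scale_facts(2,3) central g in \<open>auto intro!: continuous_intros\<close>)
  then show ?thesis using formula by (intro conjI exI[of _ a0]) auto
qed

lemma adsoft_intervals:
  assumes C: "\<And>a b. C a b = (INF m. shift_cov (adsoft_thr (s * \<eta>)) (s / \<xi> * a) (s / \<xi> * b) m)"
  shows "(\<forall>a b. 0 \<le> a \<longrightarrow> 0 \<le> b \<longrightarrow>
       C a b =
         (if a \<le> b then Phi (s * (a / \<xi> - \<eta>))
               - Phi (s / \<xi> * ((a - b) / 2 - sqrt (((a + b) / 2)\<^sup>2 + \<xi>\<^sup>2 * \<eta>\<^sup>2)))
          else Phi (s * (b / \<xi> - \<eta>))
               - Phi (s / \<xi> * ((b - a) / 2 - sqrt (((a + b) / 2)\<^sup>2 + \<xi>\<^sup>2 * \<eta>\<^sup>2)))))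
    \<and> (\<exists>!p. shortest C \<alpha> \<sigma> (fst p) (snd p))
    \<and> (\<exists>aA. 0 \<le> aA \<and> Phi (s * (aA / \<xi> - \<eta>)) - Phi (- s * sqrt ((aA / \<xi>)\<^sup>2 + \<eta>\<^sup>2)) = 1 - \<alpha>
         \<and> (\<forall>a. 0 \<le> a \<and> Phi (s * (a / \<xi> - \<eta>)) - Phi (- s * sqrt ((a / \<xi>)\<^sup>2 + \<eta>\<^sup>2)) = 1 - \<alpha> \<longrightarrow> a = aA)
         \<and> shortest C \<alpha> \<sigma> aA aA \<and> C aA aA = 1 - \<alpha> \<and> aA > 0)"
proof -
  let ?\<kappa> = "s / \<xi>" and ?e = "s * \<eta>"
  let ?h = "shrink ?e"
  note e = scale_facts(3)
  have cov: "C a b = max 0 (Phi (?\<kappa> * min a b - ?e) - Phi (- (?\<kappa> * max a b) - ?h (?\<kappa> * (a + b))))"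
    if "0 \<le> a" "0 \<le> b" for a b
  proof -
    have "?\<kappa> * min a b + ?\<kappa> * max a b = ?\<kappa> * (a + b)"
      unfolding distrib_left[symmetric] by (simp add: min_def max_def)
    moreover have "0 \<le> ?\<kappa> * min a b" "?\<kappa> * min a b \<le> ?\<kappa> * max a b"
      using that scale_facts(2) by (auto intro!: mult_left_mono simp del: times_divide_eq_left)
    note INF_shift_cov_adsoft[OF e this]
    moreover have "C a b =
        (INF m. shift_cov (adsoft_thr ?e) (?\<kappa> * min a b) (?\<kappa> * max a b) m)"
      unfolding C scale_facts(4,5) by (rule INF_shift_cov_min_max[OF adsoft_thr_measurable adsoft_thr_odd])
    ultimately show ?thesis by (simp only:)
  qed
  have central: "C a b = max 0 (central (?\<kappa> * \<bar>a - b\<bar> / 2 + (?e + ?h (?\<kappa> * (a + b))) / 2)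
      ((?\<kappa> * (a + b) - ?e + ?h (?\<kappa> * (a + b))) / 2))"
    if "0 \<le> a" "0 \<le> b" for a b
  proof -
    have "\<bar>(- (?\<kappa> * max a b) - ?h (?\<kappa> * (a + b)) + (?\<kappa> * min a b - ?e)) / 2\<bar> =
        ?\<kappa> * \<bar>a - b\<bar> / 2 + (?e + ?h (?\<kappa> * (a + b))) / 2"
      by (rule abs_centre[OF _ scale_max scale_facts(6)])
        (use scale_facts(3) shrink_pos[OF e, of "?\<kappa> * (a + b)"] in \<open>auto simp: field_simps\<close>)
    moreover have "?\<kappa> * min a b - ?e - (- (?\<kappa> * max a b) - ?h (?\<kappa> * (a + b))) =
        ?\<kappa> * (a + b) - ?e + ?h (?\<kappa> * (a + b))"
      by (simp add: algebra_simps add_divide_distrib min_def max_def)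
    ultimately show ?thesis
      unfolding cov[OF that] Phi_diff_eq_central by (metis central_abs)
  qed
  have sqrt_scale: "sqrt ((?\<kappa> * c)\<^sup>2 + ?e\<^sup>2) = ?\<kappa> * sqrt (c\<^sup>2 + \<xi>\<^sup>2 * \<eta>\<^sup>2)" for c
  proof -
    have "(?\<kappa> * c)\<^sup>2 + ?e\<^sup>2 = ?\<kappa>\<^sup>2 * (c\<^sup>2 + \<xi>\<^sup>2 * \<eta>\<^sup>2)"
      using pos by (simp add: power_mult_distrib power_divide distrib_left)
    then show ?thesis using pos by (simp add: real_sqrt_mult)
  qed
  have shrink_eq: "?h (?\<kappa> * c) = ?\<kappa> * (sqrt ((c / 2)\<^sup>2 + \<xi>\<^sup>2 * \<eta>\<^sup>2) - c / 2)" for c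
  proof -
    have "?h (?\<kappa> * c) = sqrt ((?\<kappa> * (c / 2))\<^sup>2 + ?e\<^sup>2) - ?\<kappa> * (c / 2)"
      by (simp add: shrink_def power_divide power_mult_distrib)
    then show ?thesis unfolding sqrt_scale by (simp add: right_diff_distrib)
  qed
  have formula: "C a b =
         (if a \<le> b then Phi (s * (a / \<xi> - \<eta>))
               - Phi (s / \<xi> * ((a - b) / 2 - sqrt (((a + b) / 2)\<^sup>2 + \<xi>\<^sup>2 * \<eta>\<^sup>2)))
          else Phi (s * (b / \<xi> - \<eta>))
               - Phi (s / \<xi> * ((b - a) / 2 - sqrt (((a + b) / 2)\<^sup>2 + \<xi>\<^sup>2 * \<eta>\<^sup>2))))"
    if "0 \<le> a" "0 \<le> b" for a b
  proof -
    \<comment> \<open>By \<open>eta_le_shrink\<close> the normal interval is nonempty, so the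
      truncation disappears.\<close>
    have "0 \<le> ?\<kappa> * (a + b)" using that pos by simp
    then have "?e \<le> ?\<kappa> * (a + b) + ?h (?\<kappa> * (a + b))"
      using eta_le_shrink[OF e, of "?\<kappa> * (a + b)"] by simp
    moreover have "?\<kappa> * (a + b) = ?\<kappa> * min a b + ?\<kappa> * max a b"
      unfolding distrib_left[symmetric] by (simp add: min_def max_def)
    moreover have "- q - h \<le> p - e'" if "e' \<le> S + h" "S = p + q" for p q h S e' :: real
      using that by linarith
    ultimately have "Phi (- (?\<kappa> * max a b) - ?h (?\<kappa> * (a + b))) \<le> Phi (?\<kappa> * min a b - ?e)"
      by (intro Phi_mono) blast
    moreover have "- (?\<kappa> * max a b) - ?h (?\<kappa> * (a + b)) =
        ?\<kappa> * ((min a b - max a b) / 2 - sqrt (((a + b) / 2)\<^sup>2 + \<xi>\<^sup>2 * \<eta>\<^sup>2))"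
    proof -
      have ab: "a + b = min a b + max a b" by (simp add: min_def max_def)
      have "- max a b - (S - (a + b) / 2) = (min a b - max a b) / 2 - S" for S
        unfolding ab by (simp add: field_simps)
      then have "?\<kappa> * (- max a b - (S - (a + b) / 2)) = ?\<kappa> * ((min a b - max a b) / 2 - S)" for S
        by simp
      then show ?thesis unfolding shrink_eq by (simp add: right_diff_distrib)
    qed
    ultimately show ?thesis
      unfolding cov[OF that] scale_facts(1) by (auto simp: min_def max_def)
  qed
  have g: "Phi (s * (a / \<xi> - \<eta>)) - Phi (- s * sqrt ((a / \<xi>)\<^sup>2 + \<eta>\<^sup>2)) =
      central ((?e + ?h (2 * ?\<kappa> * a)) / 2) ((2 * ?\<kappa> * a - ?e + ?h (2 * ?\<kappa> * a)) / 2)" for a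
  proof -
    have "s * sqrt ((a / \<xi>)\<^sup>2 + \<eta>\<^sup>2) = ?\<kappa> * sqrt (a\<^sup>2 + \<xi>\<^sup>2 * \<eta>\<^sup>2)"
    proof -
      have "a\<^sup>2 + \<xi>\<^sup>2 * \<eta>\<^sup>2 = \<xi>\<^sup>2 * ((a / \<xi>)\<^sup>2 + \<eta>\<^sup>2)" using pos by (simp add: power_divide distrib_left)
      then show ?thesis using pos by (simp add: real_sqrt_mult)
    qed
    moreover have "?h (2 * ?\<kappa> * a) = ?\<kappa> * sqrt (a\<^sup>2 + \<xi>\<^sup>2 * \<eta>\<^sup>2) - ?\<kappa> * a"
      using shrink_eq[of "2 * a"] by (simp add: mult.left_commute mult.assoc right_diff_distrib)
    ultimately have eq: "- s * sqrt ((a / \<xi>)\<^sup>2 + \<eta>\<^sup>2) = - (?\<kappa> * a) - ?h (2 * ?\<kappa> * a)" by simp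
    have "(- (?\<kappa> * a) - ?h (2 * ?\<kappa> * a) + (?\<kappa> * a - ?e)) / 2 = - ((?e + ?h (2 * ?\<kappa> * a)) / 2)"
      by (simp add: field_simps)
    then have "\<bar>(- (?\<kappa> * a) - ?h (2 * ?\<kappa> * a) + (?\<kappa> * a - ?e)) / 2\<bar> = \<bar>(?e + ?h (2 * ?\<kappa> * a)) / 2\<bar>"
      by (simp only: abs_minus_cancel)
    moreover have "?\<kappa> * a - ?e - (- (?\<kappa> * a) - ?h (2 * ?\<kappa> * a)) =
        2 * ?\<kappa> * a - ?e + ?h (2 * ?\<kappa> * a)" by simp
    ultimately show ?thesis
      unfolding eq scale_facts(1) Phi_diff_eq_central by (metis central_abs)
  qed
  obtain a0 where a0: "0 < a0"
    "Phi (s * (a0 / \<xi> - \<eta>)) - Phi (- s * sqrt ((a0 / \<xi>)\<^sup>2 + \<eta>\<^sup>2)) = 1 - \<alpha>"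
    "\<And>a. 0 \<le> a \<Longrightarrow> Phi (s * (a / \<xi> - \<eta>)) - Phi (- s * sqrt ((a / \<xi>)\<^sup>2 + \<eta>\<^sup>2)) = 1 - \<alpha> \<Longrightarrow> a = a0"
    "shortest C \<alpha> \<sigma> a0 a0" "C a0 a0 = 1 - \<alpha>" "\<exists>!p. shortest C \<alpha> \<sigma> (fst p) (snd p)"
  proof (rule shortest_symmetric[where C = C and \<kappa> = ?\<kappa> and \<sigma> = \<sigma> and \<alpha> = \<alpha> and
        d = "\<lambda>L. (?e + ?h L) / 2" and w = "\<lambda>L. (L - ?e + ?h L) / 2"
        and g = "\<lambda>a. Phi (s * (a / \<xi> - \<eta>)) - Phi (- s * sqrt ((a / \<xi>)\<^sup>2 + \<eta>\<^sup>2))"])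
    fix L :: real
    show "0 \<le> (?e + ?h L) / 2" using e shrink_pos[OF e, of L] by simp
    show "isCont (\<lambda>L. (?e + ?h L) / 2) L" "isCont (\<lambda>L. (L - ?e + ?h L) / 2) L"
      using isCont_shrink[OF e] by (auto intro!: continuous_intros)
  next
    fix L L' :: real assume L: "0 \<le> L" "L \<le> L'"
    then show "(?e + ?h L') / 2 \<le> (?e + ?h L) / 2" using shrink_antimono[OF e L] by simp
  next
    fix L L' :: real assume L: "0 \<le> L" "L < L'"
    \<comment> \<open>Although \<open>?h\<close> decreases, \<open>L + ?h L\<close> equals
      \<open>L / 2\<close> plus an increasing square root.\<close>
    then have "sqrt (L\<^sup>2 / 4 + ?e\<^sup>2) \<le> sqrt (L'\<^sup>2 / 4 + ?e\<^sup>2)" by (simp add: power_mono)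
    moreover have "(L - c + (p - L / 2)) / 2 < (L' - c + (p' - L' / 2)) / 2" if "p \<le> p'" for p p' c :: real
      using that L(2) by (simp add: field_simps)
    ultimately show "(L - ?e + ?h L) / 2 < (L' - ?e + ?h L') / 2"
      unfolding shrink_def by blast
  next
    show "(0 - ?e + ?h 0) / 2 \<le> 0" using shrink_0[OF e] by simp
  next
    \<comment> \<open>By \<open>eta_le_shrink\<close> the radius is at least \<open>L / 4\<close>
      for \<open>L \<ge> 0\<close>.\<close>
    have "filterlim (\<lambda>L::real. L / 4) at_top at_top" by real_asymp
    then show "filterlim (\<lambda>L. (L - ?e + ?h L) / 2) at_top at_top"
      by (rule filterlim_at_top_mono)
        (use eta_le_shrink[OF e] in \<open>auto simp: eventually_at_top_linorder field_simps intro!: exI[of _ 0]\<close>)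
  qed (use pos scale_facts(2,3) central g in auto)
  then show ?thesis using formula by (intro conjI exI[of _ a0]) auto
qed

end

theorem theorem12:
  fixes X :: "real^'k^'n" and i :: 'k and \<eta> \<sigma> \<alpha> :: real
  assumes rank: "rank X = CARD('k)"
    and eta: "\<eta> > 0" and sigma: "\<sigma> > 0" and alpha: "0 < \<alpha>" "\<alpha> < 1"
  defines "s \<equiv> sqrt (real CARD('n))" and "\<xi> \<equiv> xi X i"
  shows
   \<comment> \<open>(a) hard thresholding\<close>
   "(\<forall>a b. 0 \<le> a \<longrightarrow> 0 \<le> b \<longrightarrow>
       inf_cov X \<sigma> i (hard_est X \<sigma> \<eta> i) a b =
         (if \<xi> * \<eta> \<le> a + b then
            (if a \<le> b then Phi (s * (a / \<xi> - \<eta>)) - Phi (- s * b / \<xi>)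
             else Phi (s * (b / \<xi> - \<eta>)) - Phi (- s * a / \<xi>))
          else 0))
    \<and> (\<exists>!p. shortest (inf_cov X \<sigma> i (hard_est X \<sigma> \<eta> i)) \<alpha> \<sigma> (fst p) (snd p))
    \<and> (\<exists>aH. 0 \<le> aH \<and> Phi (s * (aH / \<xi> - \<eta>)) - Phi (- s * aH / \<xi>) = 1 - \<alpha>
         \<and> (\<forall>a. 0 \<le> a \<and> Phi (s * (a / \<xi> - \<eta>)) - Phi (- s * a / \<xi>) = 1 - \<alpha> \<longrightarrow> a = aH)
         \<and> shortest (inf_cov X \<sigma> i (hard_est X \<sigma> \<eta> i)) \<alpha> \<sigma> aH aH
         \<and> inf_cov X \<sigma> i (hard_est X \<sigma> \<eta> i) aH aH = 1 - \<alpha>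
         \<and> aH > \<xi> * \<eta> / 2)
   \<comment> \<open>(b) soft thresholding\<close>
    \<and> (\<forall>a b. 0 \<le> a \<longrightarrow> 0 \<le> b \<longrightarrow>
       inf_cov X \<sigma> i (soft_est X \<sigma> \<eta> i) a b =
         (if a \<le> b then Phi (s * (a / \<xi> - \<eta>)) - Phi (s * (- b / \<xi> - \<eta>))
          else Phi (s * (b / \<xi> - \<eta>)) - Phi (s * (- a / \<xi> - \<eta>))))
    \<and> (\<exists>!p. shortest (inf_cov X \<sigma> i (soft_est X \<sigma> \<eta> i)) \<alpha> \<sigma> (fst p) (snd p))
    \<and> (\<exists>aS. 0 \<le> aS \<and> Phi (s * (aS / \<xi> - \<eta>)) - Phi (s * (- aS / \<xi> - \<eta>)) = 1 - \<alpha>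
         \<and> (\<forall>a. 0 \<le> a \<and> Phi (s * (a / \<xi> - \<eta>)) - Phi (s * (- a / \<xi> - \<eta>)) = 1 - \<alpha> \<longrightarrow> a = aS)
         \<and> shortest (inf_cov X \<sigma> i (soft_est X \<sigma> \<eta> i)) \<alpha> \<sigma> aS aS
         \<and> inf_cov X \<sigma> i (soft_est X \<sigma> \<eta> i) aS aS = 1 - \<alpha>
         \<and> aS > 0)
   \<comment> \<open>(c) adaptive soft thresholding\<close>
    \<and> (\<forall>a b. 0 \<le> a \<longrightarrow> 0 \<le> b \<longrightarrow>
       inf_cov X \<sigma> i (adsoft_est X \<sigma> \<eta> i) a b =
         (if a \<le> b then Phi (s * (a / \<xi> - \<eta>))
               - Phi (s / \<xi> * ((a - b) / 2 - sqrt (((a + b) / 2)\<^sup>2 + \<xi>\<^sup>2 * \<eta>\<^sup>2)))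
          else Phi (s * (b / \<xi> - \<eta>))
               - Phi (s / \<xi> * ((b - a) / 2 - sqrt (((a + b) / 2)\<^sup>2 + \<xi>\<^sup>2 * \<eta>\<^sup>2)))))
    \<and> (\<exists>!p. shortest (inf_cov X \<sigma> i (adsoft_est X \<sigma> \<eta> i)) \<alpha> \<sigma> (fst p) (snd p))
    \<and> (\<exists>aA. 0 \<le> aA \<and> Phi (s * (aA / \<xi> - \<eta>)) - Phi (- s * sqrt ((aA / \<xi>)\<^sup>2 + \<eta>\<^sup>2)) = 1 - \<alpha>
         \<and> (\<forall>a. 0 \<le> a \<and> Phi (s * (a / \<xi> - \<eta>)) - Phi (- s * sqrt ((a / \<xi>)\<^sup>2 + \<eta>\<^sup>2)) = 1 - \<alpha> \<longrightarrow> a = aA)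
         \<and> shortest (inf_cov X \<sigma> i (adsoft_est X \<sigma> \<eta> i)) \<alpha> \<sigma> aA aA
         \<and> inf_cov X \<sigma> i (adsoft_est X \<sigma> \<eta> i) aA aA = 1 - \<alpha>
         \<and> aA > 0)"
proof -
  have s: "0 < s" by (simp add: s_def)
  have \<xi>: "0 < \<xi>" unfolding \<xi>_def by (rule xi_pos[OF rank])
  define \<tau> where "\<tau> = \<sigma> * \<xi> / s"
  have \<tau>: "0 < \<tau>" "\<tau> * (s * \<eta>) = \<sigma> * \<xi> * \<eta>"
    using s \<xi> sigma by (auto simp: \<tau>_def)
  have e: "0 < s * \<eta>" using s eta by simp
  note reduce = inf_cov_eq_INF_shift_cov[OF rank sigma _ meta_eq_to_obj_eq[OF s_def],
      of _ _ i, folded \<xi>_def, folded \<tau>_def]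
  have "inf_cov X \<sigma> i (hard_est X \<sigma> \<eta> i) a b =
      (INF m. shift_cov (hard_thr (s * \<eta>)) (s / \<xi> * a) (s / \<xi> * b) m)" for a b
    by (rule reduce[OF hard_thr_measurable])
      (simp add: hard_thr_scale[OF \<tau>(1)] \<tau>(2) hard_est_def Let_def \<xi>_def)
  note hard = hard_intervals[OF s \<xi> eta sigma alpha this]
  have "inf_cov X \<sigma> i (soft_est X \<sigma> \<eta> i) a b =
      (INF m. shift_cov (soft_thr (s * \<eta>)) (s / \<xi> * a) (s / \<xi> * b) m)" for a b
    by (rule reduce[OF soft_thr_measurable])
      (simp add: soft_thr_scale[OF \<tau>(1) e] \<tau>(2) soft_est_def Let_def \<xi>_def)
  note soft = soft_intervals[OF s \<xi> eta sigma alpha this]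
  have "inf_cov X \<sigma> i (adsoft_est X \<sigma> \<eta> i) a b =
      (INF m. shift_cov (adsoft_thr (s * \<eta>)) (s / \<xi> * a) (s / \<xi> * b) m)" for a b
    by (rule reduce[OF adsoft_thr_measurable])
      (simp add: adsoft_thr_scale[OF \<tau>(1) e] \<tau>(2) adsoft_est_def Let_def \<xi>_def power_mult_distrib)
  note adsoft = adsoft_intervals[OF s \<xi> eta sigma alpha this]
  from hard soft adsoft show ?thesis
    by (elim conjE) (intro conjI; assumption)
qed

end
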